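(* Let $F:\mathbb{A}\to\mathbb{B}$ and $G:\mathbb{B}\to\mathbb{A}$ be functors between arbitrary categories with $F$ left adjoint to $G$, with unit $\eta:\mathrm{Id}_{\mathbb{A}}\to GF$ and counit $\varepsilon:FG\to \mathrm{Id}_{\mathbb{B}}$. Suppose that $(F,G)$ is an idempotent pair of adjoints. Then: (i) $\mathbb{A}_{GF}\simeq\mathrm{Fix}(GF,\eta)=GF(\mathbb{A})$ is a reflective subcategory of $\mathbb{A}$ with reflector $GF$. (ii) $\mathbb{B}^{FG}\simeq\mathrm{Fix}(FG,\varepsilon)=FG(\mathbb{B})$ is a coreflective subcategory of $\mathbb{B}$ with coreflector $FG$. (iii) The (restrictions of the) functors $F$, $G$ induce an equivalence $$F:GF(\mathbb{A})\to FG(\mathbb{B}),\qquad G:FG(\mathbb{B})\to GF(\mathbb{A}).$$ (iv) The Kleisli category of the monad $GF$ is isomorphic to the category of fractions $\mathbb{A}[S^{-1}]$, where $S$ is the family of morphisms of $\mathbb{A}$ rendered invertible by $GF$ (or, equivalently, by $F$).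
   Context: $GF$ denotes the monad $(GF,\,G\varepsilon F,\,\eta)$ on $\mathbb{A}$ and $FG$ the comonad $(FG,\,F\eta G,\,\varepsilon)$ on $\mathbb{B}$. $\mathbb{A}_{GF}$ is the category of modules (Eilenberg–Moore algebras) of the monad $GF$, and $\mathbb{B}^{FG}$ is the category of comodules (Eilenberg–Moore coalgebras) of the comonad $FG$. The equivalences in (i) and (ii) are those given by the forgetful functors $\mathbb{A}_{GF}\to\mathbb{A}$ and $\mathbb{B}^{FG}\to\mathbb{B}$. The adjoint pair $(F,G)$ is called idempotent if the following equivalent conditions hold: $\varepsilon F:FGF\to F$ is an isomorphism; $\eta G:G\to GFG$ is an isomorphism; $G\varepsilon F:GFGF\to GF$ is an isomorphism; $F\eta G:FG\to FGFG$ is an isomorphism; the forgetful functor $\mathbb{A}_{GF}\to\mathbb{A}$ is full and faithful; the forgetful functor $\mathbb{B}^{FG}\to\mathbb{B}$ is full and faithful. $\mathrm{Fix}(GF,\eta)$ is the full subcategory of $\mathbb{A}$ of those $A$ for which $\eta_A:A\to GF(A)$ is an isomorphism; $\mathrm{Fix}(FG,\varepsilon)$ is the full subcategory of $\mathbb{B}$ of those $B$ for which $\varepsilon_B:FG(B)\to B$ is an isomorphism. $GF(\mathbb{A})$ and $FG(\mathbb{B})$ denote the closures under isomorphism of the images of $GF$ in $\mathbb{A}$ and of $FG$ in $\mathbb{B}$ (as full subcategories). *)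

theory Defs
  imports Main
begin

section \<open>Categories, functors and natural transformations\<close>

record ('o, 'm) cat =
  Obj :: "'o set"
  Arr :: "'m set"
  Dom :: "'m \<Rightarrow> 'o"
  Cod :: "'m \<Rightarrow> 'o"
  Ident :: "'o \<Rightarrow> 'm"
  Comp :: "'m \<Rightarrow> 'm \<Rightarrow> 'm"  \<comment> \<open>\<open>Comp C g f\<close> is "first f, then g"\<close>

definition hom :: "('o, 'm) cat \<Rightarrow> 'o \<Rightarrow> 'o \<Rightarrow> 'm set" where
  "hom C a b = {f \<in> Arr C. Dom C f = a \<and> Cod C f = b}"

locale category =
  fixes C :: "('o, 'm) cat"
  assumes Dom_Obj: "f \<in> Arr C \<Longrightarrow> Dom C f \<in> Obj C"
    and Cod_Obj: "f \<in> Arr C \<Longrightarrow> Cod C f \<in> Obj C"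
    and Ident_hom: "a \<in> Obj C \<Longrightarrow> Ident C a \<in> hom C a a"
    and Comp_hom: "f \<in> hom C a b \<Longrightarrow> g \<in> hom C b c \<Longrightarrow> Comp C g f \<in> hom C a c"
    and Comp_Ident_right: "f \<in> hom C a b \<Longrightarrow> Comp C f (Ident C a) = f"
    and Comp_Ident_left: "f \<in> hom C a b \<Longrightarrow> Comp C (Ident C b) f = f"
    and Comp_assoc: "f \<in> hom C a b \<Longrightarrow> g \<in> hom C b c \<Longrightarrow> h \<in> hom C c d \<Longrightarrow>
      Comp C h (Comp C g f) = Comp C (Comp C h g) f"

definition iso :: "('o, 'm) cat \<Rightarrow> 'm \<Rightarrow> bool" where
  "iso C f \<longleftrightarrow> f \<in> Arr C \<and> (\<exists>g \<in> hom C (Cod C f) (Dom C f).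
     Comp C g f = Ident C (Dom C f) \<and> Comp C f g = Ident C (Cod C f))"

definition isomorphic_objects :: "('o, 'm) cat \<Rightarrow> 'o \<Rightarrow> 'o \<Rightarrow> bool" where
  "isomorphic_objects C a b \<longleftrightarrow> (\<exists>f \<in> hom C a b. iso C f)"

record ('o, 'm, 'p, 'n) func =
  OMap :: "'o \<Rightarrow> 'p"
  AMap :: "'m \<Rightarrow> 'n"

locale is_functor = source: category C + target: category D
  for C :: "('o, 'm) cat" and D :: "('p, 'n) cat" +
  fixes F :: "('o, 'm, 'p, 'n) func"
  assumes OMap_Obj: "a \<in> Obj C \<Longrightarrow> OMap F a \<in> Obj D"
    and AMap_hom: "f \<in> hom C a b \<Longrightarrow> AMap F f \<in> hom D (OMap F a) (OMap F b)"
    and AMap_Ident: "a \<in> Obj C \<Longrightarrow> AMap F (Ident C a) = Ident D (OMap F a)"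
    and AMap_Comp: "f \<in> hom C a b \<Longrightarrow> g \<in> hom C b c \<Longrightarrow>
      AMap F (Comp C g f) = Comp D (AMap F g) (AMap F f)"

definition id_functor :: "('o, 'm, 'o, 'm) func" where
  "id_functor = \<lparr>OMap = (\<lambda>a. a), AMap = (\<lambda>f. f)\<rparr>"

definition comp_functor ::
    "('p, 'n, 'q, 'k) func \<Rightarrow> ('o, 'm, 'p, 'n) func \<Rightarrow> ('o, 'm, 'q, 'k) func"
    (infixr "\<odot>" 70) where
  "G \<odot> F = \<lparr>OMap = (\<lambda>a. OMap G (OMap F a)), AMap = (\<lambda>f. AMap G (AMap F f))\<rparr>"

text \<open>Functors are total functions on types, so equality of functors out of \<open>C\<close> only concerns
  objects and arrows of \<open>C\<close>.\<close>

definition functor_eq ::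
    "('o, 'm) cat \<Rightarrow> ('o, 'm, 'p, 'n) func \<Rightarrow> ('o, 'm, 'p, 'n) func \<Rightarrow> bool" where
  "functor_eq C F G \<longleftrightarrow>
     (\<forall>a \<in> Obj C. OMap F a = OMap G a) \<and> (\<forall>f \<in> Arr C. AMap F f = AMap G f)"

locale natural_transformation = F: is_functor C D F + G: is_functor C D G
  for C :: "('o, 'm) cat" and D :: "('p, 'n) cat"
    and F G :: "('o, 'm, 'p, 'n) func" +
  fixes t :: "'o \<Rightarrow> 'n"
  assumes component_hom: "a \<in> Obj C \<Longrightarrow> t a \<in> hom D (OMap F a) (OMap G a)"
    and naturality: "f \<in> hom C a b \<Longrightarrow> Comp D (t b) (AMap F f) = Comp D (AMap G f) (t a)"

locale natural_isomorphism = natural_transformation +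
  assumes component_iso: "a \<in> Obj C \<Longrightarrow> iso D (t a)"

definition full_and_faithful ::
    "('o, 'm) cat \<Rightarrow> ('p, 'n) cat \<Rightarrow> ('o, 'm, 'p, 'n) func \<Rightarrow> bool" where
  "full_and_faithful C D F \<longleftrightarrow> is_functor C D F \<and>
     (\<forall>a \<in> Obj C. \<forall>b \<in> Obj C. bij_betw (AMap F) (hom C a b) (hom D (OMap F a) (OMap F b)))"

definition inverse_equivalences ::
    "('o, 'm) cat \<Rightarrow> ('p, 'n) cat \<Rightarrow> ('o, 'm, 'p, 'n) func \<Rightarrow> ('p, 'n, 'o, 'm) func \<Rightarrow> bool" where
  "inverse_equivalences C D F G \<longleftrightarrow> is_functor C D F \<and> is_functor D C G \<and>
     (\<exists>t. natural_isomorphism C C id_functor (G \<odot> F) t) \<and>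
     (\<exists>t. natural_isomorphism D D (F \<odot> G) id_functor t)"

definition is_equivalence ::
    "('o, 'm) cat \<Rightarrow> ('p, 'n) cat \<Rightarrow> ('o, 'm, 'p, 'n) func \<Rightarrow> bool" where
  "is_equivalence C D F \<longleftrightarrow> (\<exists>G. inverse_equivalences C D F G)"

definition category_isomorphism ::
    "('o, 'm) cat \<Rightarrow> ('p, 'n) cat \<Rightarrow> ('o, 'm, 'p, 'n) func \<Rightarrow> bool" where
  "category_isomorphism C D F \<longleftrightarrow> is_functor C D F \<and>
     (\<exists>G. is_functor D C G \<and> functor_eq C (G \<odot> F) id_functor \<and> functor_eq D (F \<odot> G) id_functor)"


section \<open>Adjunctions, reflective and coreflective subcategories\<close>

locale adjunction =
    F: is_functor A B F + G: is_functor B A G +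
    unit: natural_transformation A A id_functor "G \<odot> F" \<eta> +
    counit: natural_transformation B B "F \<odot> G" id_functor \<epsilon>
  for A :: "('o, 'm) cat" and B :: "('p, 'n) cat"
    and F :: "('o, 'm, 'p, 'n) func" and G :: "('p, 'n, 'o, 'm) func"
    and \<eta> :: "'o \<Rightarrow> 'm" and \<epsilon> :: "'p \<Rightarrow> 'n" +
  assumes triangle_F:
      "a \<in> Obj A \<Longrightarrow> Comp B (\<epsilon> (OMap F a)) (AMap F (\<eta> a)) = Ident B (OMap F a)"
    and triangle_G:
      "b \<in> Obj B \<Longrightarrow> Comp A (AMap G (\<epsilon> b)) (\<eta> (OMap G b)) = Ident A (OMap G b)"

definition full_subcategory :: "('o, 'm) cat \<Rightarrow> 'o set \<Rightarrow> ('o, 'm) cat" where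
  "full_subcategory C X = C\<lparr>Obj := X, Arr := {f \<in> Arr C. Dom C f \<in> X \<and> Cod C f \<in> X}\<rparr>"

text \<open>That the identity maps form a functor \<open>D \<rightarrow> C\<close> says precisely that \<open>D\<close> is a subcategory
  of \<open>C\<close>; this functor is then the inclusion.\<close>

definition subcategory :: "('o, 'm) cat \<Rightarrow> ('o, 'm) cat \<Rightarrow> bool" where
  "subcategory D C \<longleftrightarrow> is_functor D C id_functor"

definition reflective_subcategory ::
    "('o, 'm) cat \<Rightarrow> ('o, 'm) cat \<Rightarrow> ('o, 'm, 'o, 'm) func \<Rightarrow> bool" where
  "reflective_subcategory C D R \<longleftrightarrow> subcategory D C \<and>
     (\<exists>\<eta> \<epsilon>. adjunction C D R id_functor \<eta> \<epsilon>)"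

definition coreflective_subcategory ::
    "('o, 'm) cat \<Rightarrow> ('o, 'm) cat \<Rightarrow> ('o, 'm, 'o, 'm) func \<Rightarrow> bool" where
  "coreflective_subcategory C D R \<longleftrightarrow> subcategory D C \<and>
     (\<exists>\<eta> \<epsilon>. adjunction D C id_functor R \<eta> \<epsilon>)"


section \<open>Modules, comodules and Kleisli categories\<close>

record ('o, 'm) monad =
  Endo :: "('o, 'm, 'o, 'm) func"
  Mult :: "'o \<Rightarrow> 'm"
  Unit :: "'o \<Rightarrow> 'm"

record ('o, 'm) comonad =
  Coendo :: "('o, 'm, 'o, 'm) func"
  Comult :: "'o \<Rightarrow> 'm"
  Counit :: "'o \<Rightarrow> 'm"

definition induced_monad ::
    "('o, 'm, 'p, 'n) func \<Rightarrow> ('p, 'n, 'o, 'm) func \<Rightarrow> ('o \<Rightarrow> 'm) \<Rightarrow> ('p \<Rightarrow> 'n) \<Rightarrow> ('o, 'm) monad" where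
  "induced_monad F G \<eta> \<epsilon> = \<lparr>Endo = G \<odot> F, Mult = (\<lambda>a. AMap G (\<epsilon> (OMap F a))), Unit = \<eta>\<rparr>"

definition induced_comonad ::
    "('o, 'm, 'p, 'n) func \<Rightarrow> ('p, 'n, 'o, 'm) func \<Rightarrow> ('o \<Rightarrow> 'm) \<Rightarrow> ('p \<Rightarrow> 'n) \<Rightarrow> ('p, 'n) comonad" where
  "induced_comonad F G \<eta> \<epsilon> = \<lparr>Coendo = F \<odot> G, Comult = (\<lambda>b. AMap F (\<eta> (OMap G b))), Counit = \<epsilon>\<rparr>"

definition modules :: "('o, 'm) cat \<Rightarrow> ('o, 'm) monad \<Rightarrow> ('o \<times> 'm) set" where
  "modules C T = {(a, h). a \<in> Obj C \<and> h \<in> hom C (OMap (Endo T) a) a \<and>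
     Comp C h (Unit T a) = Ident C a \<and>
     Comp C h (AMap (Endo T) h) = Comp C h (Mult T a)}"

text \<open>Arrows carry their domain and codomain: one arrow of the base category may underlie
  several module morphisms.\<close>

definition module_category ::
    "('o, 'm) cat \<Rightarrow> ('o, 'm) monad \<Rightarrow> ('o \<times> 'm, ('o \<times> 'm) \<times> ('o \<times> 'm) \<times> 'm) cat" where
  "module_category C T = \<lparr>
     Obj = modules C T,
     Arr = {(x, y, f). x \<in> modules C T \<and> y \<in> modules C T \<and> f \<in> hom C (fst x) (fst y) \<and>
       Comp C f (snd x) = Comp C (snd y) (AMap (Endo T) f)},
     Dom = (\<lambda>(x, y, f). x),
     Cod = (\<lambda>(x, y, f). y),
     Ident = (\<lambda>x. (x, x, Ident C (fst x))),
     Comp = (\<lambda>(y, z, g) (x, _, f). (x, z, Comp C g f))\<rparr>"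

definition comodules :: "('o, 'm) cat \<Rightarrow> ('o, 'm) comonad \<Rightarrow> ('o \<times> 'm) set" where
  "comodules C W = {(b, k). b \<in> Obj C \<and> k \<in> hom C b (OMap (Coendo W) b) \<and>
     Comp C (Counit W b) k = Ident C b \<and>
     Comp C (AMap (Coendo W) k) k = Comp C (Comult W b) k}"

definition comodule_category ::
    "('o, 'm) cat \<Rightarrow> ('o, 'm) comonad \<Rightarrow> ('o \<times> 'm, ('o \<times> 'm) \<times> ('o \<times> 'm) \<times> 'm) cat" where
  "comodule_category C W = \<lparr>
     Obj = comodules C W,
     Arr = {(x, y, f). x \<in> comodules C W \<and> y \<in> comodules C W \<and> f \<in> hom C (fst x) (fst y) \<and>
       Comp C (snd y) f = Comp C (AMap (Coendo W) f) (snd x)},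
     Dom = (\<lambda>(x, y, f). x),
     Cod = (\<lambda>(x, y, f). y),
     Ident = (\<lambda>x. (x, x, Ident C (fst x))),
     Comp = (\<lambda>(y, z, g) (x, _, f). (x, z, Comp C g f))\<rparr>"

definition forgetful ::
    "('o \<times> 'm, ('o \<times> 'm) \<times> ('o \<times> 'm) \<times> 'm, 'o, 'm) func" where
  "forgetful = \<lparr>OMap = fst, AMap = (\<lambda>(x, y, f). f)\<rparr>"

definition kleisli_category ::
    "('o, 'm) cat \<Rightarrow> ('o, 'm) monad \<Rightarrow> ('o, 'o \<times> 'o \<times> 'm) cat" where
  "kleisli_category C T = \<lparr>
     Obj = Obj C,
     Arr = {(a, b, f). a \<in> Obj C \<and> b \<in> Obj C \<and> f \<in> hom C a (OMap (Endo T) b)},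
     Dom = (\<lambda>(a, b, f). a),
     Cod = (\<lambda>(a, b, f). b),
     Ident = (\<lambda>a. (a, a, Unit T a)),
     Comp = (\<lambda>(b, c, g) (a, _, f).
       (a, c, Comp C (Mult T c) (Comp C (AMap (Endo T) g) f)))\<rparr>"

definition kleisli_functor ::
    "('o, 'm) cat \<Rightarrow> ('o, 'm) monad \<Rightarrow> ('o, 'm, 'o, 'o \<times> 'o \<times> 'm) func" where
  "kleisli_functor C T = \<lparr>
     OMap = (\<lambda>a. a),
     AMap = (\<lambda>f. (Dom C f, Cod C f, Comp C (Unit T (Cod C f)) f))\<rparr>"


section \<open>Categories of fractions\<close>

text \<open>The Gabriel--Zisman construction of \<open>C[S\<^sup>-\<^sup>1]\<close>: arrows are paths in the graph obtained from
  \<open>C\<close> by adding a reversed edge \<open>Bwd s\<close> for each \<open>s \<in> S\<close>, modulo the congruence that makes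
  \<open>Fwd\<close> functorial and \<open>Bwd s\<close> inverse to \<open>Fwd s\<close>. Paths are listed in the order in which they
  are traversed, so the list \<open>[Fwd f, Fwd g]\<close> represents the composite \<open>g \<circ> f\<close>.\<close>

datatype 'm edge = Fwd 'm | Bwd 'm

fun edge_from_to :: "('o, 'm) cat \<Rightarrow> 'm set \<Rightarrow> 'o \<Rightarrow> 'm edge \<Rightarrow> 'o \<Rightarrow> bool" where
  "edge_from_to C S a (Fwd f) b \<longleftrightarrow> f \<in> hom C a b"
| "edge_from_to C S a (Bwd s) b \<longleftrightarrow> s \<in> S \<and> s \<in> hom C b a"

fun path :: "('o, 'm) cat \<Rightarrow> 'm set \<Rightarrow> 'o \<Rightarrow> 'm edge list \<Rightarrow> 'o \<Rightarrow> bool" where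
  "path C S a [] b \<longleftrightarrow> a \<in> Obj C \<and> a = b"
| "path C S a (e # w) b \<longleftrightarrow> (\<exists>c. edge_from_to C S a e c \<and> path C S c w b)"

inductive path_eq :: "('o, 'm) cat \<Rightarrow> 'm set \<Rightarrow> 'o \<Rightarrow> 'o \<Rightarrow> 'm edge list \<Rightarrow> 'm edge list \<Rightarrow> bool"
  for C S where
  path_refl: "path C S a u b \<Longrightarrow> path_eq C S a b u u"
| path_sym: "path_eq C S a b u v \<Longrightarrow> path_eq C S a b v u"
| path_trans: "path_eq C S a b u v \<Longrightarrow> path_eq C S a b v w \<Longrightarrow> path_eq C S a b u w"
| path_append: "path_eq C S a b u u' \<Longrightarrow> path_eq C S b c v v' \<Longrightarrow> path_eq C S a c (u @ v) (u' @ v')"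
| path_Ident: "a \<in> Obj C \<Longrightarrow> path_eq C S a a [Fwd (Ident C a)] []"
| path_Comp: "f \<in> hom C a b \<Longrightarrow> g \<in> hom C b c \<Longrightarrow>
    path_eq C S a c [Fwd f, Fwd g] [Fwd (Comp C g f)]"
| path_Fwd_Bwd: "s \<in> S \<Longrightarrow> s \<in> hom C a b \<Longrightarrow> path_eq C S a a [Fwd s, Bwd s] []"
| path_Bwd_Fwd: "s \<in> S \<Longrightarrow> s \<in> hom C a b \<Longrightarrow> path_eq C S b b [Bwd s, Fwd s] []"

definition path_class ::
    "('o, 'm) cat \<Rightarrow> 'm set \<Rightarrow> 'o \<Rightarrow> 'o \<Rightarrow> 'm edge list \<Rightarrow> 'm edge list set" where
  "path_class C S a b w = {w'. path_eq C S a b w w'}"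

definition fractions ::
    "('o, 'm) cat \<Rightarrow> 'm set \<Rightarrow> ('o, 'o \<times> 'o \<times> 'm edge list set) cat" where
  "fractions C S = \<lparr>
     Obj = Obj C,
     Arr = {(a, b, X). \<exists>w. path C S a w b \<and> X = path_class C S a b w},
     Dom = (\<lambda>(a, b, X). a),
     Cod = (\<lambda>(a, b, X). b),
     Ident = (\<lambda>a. (a, a, path_class C S a a [])),
     Comp = (\<lambda>(b, c, Y) (a, _, X). (a, c, \<Union>u \<in> X. \<Union>v \<in> Y. path_class C S a c (u @ v)))\<rparr>"

definition localization ::
    "('o, 'm) cat \<Rightarrow> 'm set \<Rightarrow> ('o, 'm, 'o, 'o \<times> 'o \<times> 'm edge list set) func" where
  "localization C S = \<lparr>
     OMap = (\<lambda>a. a),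
     AMap = (\<lambda>f. (Dom C f, Cod C f, path_class C S (Dom C f) (Cod C f) [Fwd f]))\<rparr>"

definition inverted_arrows ::
    "('o, 'm) cat \<Rightarrow> ('p, 'n) cat \<Rightarrow> ('o, 'm, 'p, 'n) func \<Rightarrow> 'm set" where
  "inverted_arrows C D F = {f \<in> Arr C. iso D (AMap F f)}"


section \<open>Idempotent pairs of adjoints\<close>

definition Fix :: "('o, 'm) cat \<Rightarrow> ('o \<Rightarrow> 'm) \<Rightarrow> ('o, 'm) cat" where
  "Fix C t = full_subcategory C {a \<in> Obj C. iso C (t a)}"

definition image_closure ::
    "('o, 'm) cat \<Rightarrow> ('o, 'm, 'o, 'm) func \<Rightarrow> ('o, 'm) cat" where
  "image_closure C T = full_subcategory C
     {a \<in> Obj C. \<exists>c \<in> Obj C. isomorphic_objects C a (OMap T c)}"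

definition idempotent_pair ::
    "('o, 'm) cat \<Rightarrow> ('p, 'n) cat \<Rightarrow> ('o, 'm, 'p, 'n) func \<Rightarrow> ('p, 'n, 'o, 'm) func \<Rightarrow>
      ('o \<Rightarrow> 'm) \<Rightarrow> ('p \<Rightarrow> 'n) \<Rightarrow> bool" where
  "idempotent_pair A B F G \<eta> \<epsilon> \<longleftrightarrow> adjunction A B F G \<eta> \<epsilon> \<and>
     natural_isomorphism A B (F \<odot> G \<odot> F) F (\<lambda>a. \<epsilon> (OMap F a))"

text \<open>Idempotency is defined by the first of six equivalent conditions; the lemma
  \<open>idempotent_conditions\<close> at the end proves the equivalence of all six.\<close>

lemma homI: "f \<in> Arr C \<Longrightarrow> f \<in> hom C (Dom C f) (Cod C f)"
  by (simp add: hom_def)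

lemma isoI:
  assumes "f \<in> hom C a b" "g \<in> hom C b a" "Comp C g f = Ident C a" "Comp C f g = Ident C b"
  shows "iso C f"
  using assms by (auto simp: iso_def hom_def)

lemma isoE:
  assumes "iso C f" "f \<in> hom C a b"
  obtains g where "g \<in> hom C b a" "Comp C g f = Ident C a" "Comp C f g = Ident C b"
  using assms by (auto simp: iso_def hom_def)

lemma (in category) inverse_unique:
  assumes "f \<in> hom C a b" "g \<in> hom C b a" "h \<in> hom C b a"
    "Comp C g f = Ident C a" "Comp C f h = Ident C b"
  shows "g = h"
  using Comp_assoc[OF assms(3,1,2)] assms(4,5) Comp_Ident_left[OF assms(3)] Comp_Ident_right[OF assms(2)]
  by simp

lemma (in category) iso_section:
  assumes f: "f \<in> hom C a b" and g: "g \<in> hom C b a" and e: "Comp C f g = Ident C b" and i: "iso C f"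
  shows "Comp C g f = Ident C a"
  using isoE[OF i f] inverse_unique[OF f _ g _ e] by metis

lemma (in is_functor) AMap_iso: "iso C f \<Longrightarrow> iso D (AMap F f)"
proof -
  assume i: "iso C f"
  then have f: "f \<in> hom C (Dom C f) (Cod C f)" by (simp add: iso_def homI)
  obtain g where g: "g \<in> hom C (Cod C f) (Dom C f)" "Comp C g f = Ident C (Dom C f)"
    "Comp C f g = Ident C (Cod C f)" using isoE[OF i f] .
  have o: "Dom C f \<in> Obj C" "Cod C f \<in> Obj C"
    using i by (auto simp: iso_def source.Dom_Obj source.Cod_Obj)
  show ?thesis
    by (rule isoI[OF AMap_hom[OF f] AMap_hom[OF g(1)]])
      (simp_all flip: AMap_Comp[OF f g(1)] AMap_Comp[OF g(1) f] add: g o AMap_Ident)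
qed

lemma (in category) Comp_functor: "is_functor C D F \<Longrightarrow> is_functor D E G \<Longrightarrow> is_functor C E (G \<odot> F)"
proof -
  assume F: "is_functor C D F" and G: "is_functor D E G"
  interpret F: is_functor C D F by fact
  interpret G: is_functor D E G by fact
  show ?thesis
    by unfold_locales
      (auto simp: comp_functor_def F.OMap_Obj G.OMap_Obj F.AMap_Ident G.AMap_Ident
        F.AMap_hom G.AMap_hom F.AMap_Comp G.AMap_Comp[OF F.AMap_hom F.AMap_hom])
qed

definition dual :: "('o, 'm) cat \<Rightarrow> ('o, 'm) cat" where
  "dual C = C\<lparr>Dom := Cod C, Cod := Dom C, Comp := (\<lambda>g f. Comp C f g)\<rparr>"

lemma dual_simps [simp]:
  "Obj (dual C) = Obj C" "Arr (dual C) = Arr C" "Dom (dual C) = Cod C" "Cod (dual C) = Dom C"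
  "Ident (dual C) = Ident C" "Comp (dual C) g f = Comp C f g" "hom (dual C) a b = hom C b a"
  by (auto simp: dual_def hom_def)

lemma iso_dual [simp]: "iso (dual C) f = iso C f"
  by (auto simp: iso_def)

lemma category_dual: "category C \<Longrightarrow> category (dual C)"
proof -
  assume "category C"
  then interpret category C .
  show ?thesis
    by (rule category.intro)
      (auto intro: Dom_Obj Cod_Obj Ident_hom Comp_hom Comp_Ident_left Comp_Ident_right simp: Comp_assoc)
qed

lemma functor_dual: "is_functor C D F \<Longrightarrow> is_functor (dual C) (dual D) F"
proof -
  assume "is_functor C D F"
  then interpret is_functor C D F .
  show ?thesis
    by (intro is_functor.intro is_functor_axioms.intro category_dual
        source.category_axioms target.category_axioms)
      (auto simp: OMap_Obj AMap_hom AMap_Ident AMap_Comp)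
qed

lemma nat_dual: "natural_transformation C D F G t \<Longrightarrow> natural_transformation (dual C) (dual D) G F t"
  by (auto simp: natural_transformation_def natural_transformation_axioms_def functor_dual)

lemma adjunction_dual: "adjunction A B F G \<eta> \<epsilon> \<Longrightarrow> adjunction (dual B) (dual A) G F \<epsilon> \<eta>"
  by (auto simp: adjunction_def adjunction_axioms_def functor_dual nat_dual)

lemma nat_iso_dual: "natural_isomorphism C D F G t \<Longrightarrow> natural_isomorphism (dual C) (dual D) G F t"
  by (auto simp: natural_isomorphism_def natural_isomorphism_axioms_def nat_dual)

lemma module_category_simps:
  "Obj (module_category C T) = modules C T"
  "Ident (module_category C T) x = (x, x, Ident C (fst x))"
  "Comp (module_category C T) (y, z, g) (x, y', f) = (x, z, Comp C g f)"
  "Dom (module_category C T) (x, y, f) = x"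
  "Cod (module_category C T) (x, y, f) = y"
  by (simp_all add: module_category_def)

lemma Arr_module_category: "(x, y, f) \<in> Arr (module_category C T) \<longleftrightarrow>
    x \<in> modules C T \<and> y \<in> modules C T \<and> f \<in> hom C (fst x) (fst y) \<and>
    Comp C f (snd x) = Comp C (snd y) (AMap (Endo T) f)"
  by (simp add: module_category_def)

lemma hom_module_category: "p \<in> hom (module_category C T) x y \<longleftrightarrow>
    (\<exists>f. p = (x, y, f) \<and> x \<in> modules C T \<and> y \<in> modules C T \<and> f \<in> hom C (fst x) (fst y) \<and>
      Comp C f (snd x) = Comp C (snd y) (AMap (Endo T) f))"
  unfolding hom_def[of "module_category C T"]
  by (cases p) (auto simp: Arr_module_category module_category_simps)

context adjunction
begin

lemma unit_hom: "a \<in> Obj A \<Longrightarrow> \<eta> a \<in> hom A a (OMap G (OMap F a))"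
  using unit.component_hom by (simp add: id_functor_def comp_functor_def)

lemma counit_hom: "b \<in> Obj B \<Longrightarrow> \<epsilon> b \<in> hom B (OMap F (OMap G b)) b"
  using counit.component_hom by (simp add: id_functor_def comp_functor_def)

lemma unit_nat: "f \<in> hom A a b \<Longrightarrow> Comp A (\<eta> b) f = Comp A (AMap G (AMap F f)) (\<eta> a)"
  using unit.naturality by (simp add: id_functor_def comp_functor_def)

lemma counit_nat: "f \<in> hom B a b \<Longrightarrow> Comp B (\<epsilon> b) (AMap F (AMap G f)) = Comp B f (\<epsilon> a)"
  using counit.naturality by (simp add: id_functor_def comp_functor_def)

lemma unit_G_iso:
  assumes i: "\<And>a. a \<in> Obj A \<Longrightarrow> iso A (AMap G (\<epsilon> (OMap F a)))" and b: "b \<in> Obj B"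
  shows "iso A (\<eta> (OMap G b))"
proof -
  let ?a = "OMap G b" let ?Ta = "OMap G (OMap F ?a)" let ?TTa = "OMap G (OMap F ?Ta)"
  have a: "?a \<in> Obj A" "?Ta \<in> Obj A" using b by (simp_all add: F.OMap_Obj G.OMap_Obj)
  have m: "AMap G (\<epsilon> (OMap F ?a)) \<in> hom A ?TTa ?Ta"
    using a by (intro G.AMap_hom counit_hom F.OMap_Obj)
  have h1: "\<eta> ?Ta \<in> hom A ?Ta ?TTa" using unit_hom a by simp
  have h2: "AMap G (AMap F (\<eta> ?a)) \<in> hom A ?Ta ?TTa"
    using a by (intro G.AMap_hom F.AMap_hom unit_hom)
  have e1: "Comp A (AMap G (\<epsilon> (OMap F ?a))) (\<eta> ?Ta) = Ident A ?Ta"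
    using triangle_G[OF F.OMap_Obj[OF a(1)]] .
  have "Comp A (AMap G (\<epsilon> (OMap F ?a))) (AMap G (AMap F (\<eta> ?a))) = Ident A ?Ta"
    using a by (subst G.AMap_Comp[symmetric, OF F.AMap_hom[OF unit_hom[OF a(1)]]
      counit_hom[OF F.OMap_Obj[OF a(1)]]]) (simp add: triangle_F G.AMap_Ident F.OMap_Obj)
  then have eq: "\<eta> ?Ta = AMap G (AMap F (\<eta> ?a))"
    using F.source.inverse_unique[OF m h1 h2] F.source.iso_section[OF m h1 e1 i[OF a(1)]] by simp
  have u: "\<eta> ?a \<in> hom A ?a ?Ta" and v: "AMap G (\<epsilon> b) \<in> hom A ?Ta ?a"
    using a b by (auto intro: unit_hom G.AMap_hom counit_hom)
  have "Comp A (\<eta> ?a) (AMap G (\<epsilon> b)) = Comp A (AMap G (AMap F (AMap G (\<epsilon> b)))) (\<eta> ?Ta)"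
    using unit_nat[OF v] .
  also have "\<dots> = AMap G (AMap F (Comp A (AMap G (\<epsilon> b)) (\<eta> ?a)))"
    unfolding eq F.AMap_Comp[OF u v] G.AMap_Comp[OF F.AMap_hom[OF u] F.AMap_hom[OF v]] ..
  also have "\<dots> = Ident A ?Ta"
    using a b by (simp add: triangle_G F.AMap_Ident G.AMap_Ident F.OMap_Obj)
  finally show ?thesis
    using isoI[OF u v] triangle_G[OF b] by simp
qed

lemma module_functor:
  "is_functor (module_category A (induced_monad F G \<eta> \<epsilon>)) A forgetful"
proof -
  let ?T = "induced_monad F G \<eta> \<epsilon>"
  let ?M = "module_category A ?T"
  have GF: "is_functor A A (G \<odot> F)"
    using F.source.Comp_functor F.is_functor_axioms G.is_functor_axioms by blast
  interpret T: is_functor A A "Endo ?T" using GF by (simp add: induced_monad_def)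
  have cp: "Comp A (Comp A g f) (snd x) = Comp A (snd z) (AMap (Endo ?T) (Comp A g f))"
    if "x \<in> modules A ?T" "y \<in> modules A ?T" "z \<in> modules A ?T"
      and f: "f \<in> hom A (fst x) (fst y)" and g: "g \<in> hom A (fst y) (fst z)"
      and ef: "Comp A f (snd x) = Comp A (snd y) (AMap (Endo ?T) f)"
      and eg: "Comp A g (snd y) = Comp A (snd z) (AMap (Endo ?T) g)" for x y z f g
  proof -
    have s: "snd x \<in> hom A (OMap (Endo ?T) (fst x)) (fst x)"
      "snd y \<in> hom A (OMap (Endo ?T) (fst y)) (fst y)"
      "snd z \<in> hom A (OMap (Endo ?T) (fst z)) (fst z)"
      using that(1-3) by (auto simp: modules_def)
    note t = T.AMap_hom[OF f] T.AMap_hom[OF g]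
    have "Comp A (Comp A g f) (snd x) = Comp A g (Comp A f (snd x))"
      using F.source.Comp_assoc[OF s(1) f g] by simp
    also have "\<dots> = Comp A (Comp A g (snd y)) (AMap (Endo ?T) f)"
      unfolding ef using F.source.Comp_assoc[OF t(1) s(2) g] by simp
    also have "\<dots> = Comp A (snd z) (Comp A (AMap (Endo ?T) g) (AMap (Endo ?T) f))"
      unfolding eg using F.source.Comp_assoc[OF t s(3)] by simp
    finally show ?thesis using T.AMap_Comp[OF f g] by simp
  qed
  have cat: "category ?M"
  proof
    fix f assume "f \<in> Arr ?M"
    then show "Dom ?M f \<in> Obj ?M" "Cod ?M f \<in> Obj ?M"
      by (cases f; simp add: Arr_module_category module_category_simps)+
  next
    fix a assume "a \<in> Obj ?M"
    then have x: "a \<in> modules A ?T" by (simp add: module_category_simps)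
    then have s: "fst a \<in> Obj A" "snd a \<in> hom A (OMap (Endo ?T) (fst a)) (fst a)"
      by (auto simp: modules_def)
    show "Ident ?M a \<in> hom ?M a a"
      using x s by (simp add: hom_module_category module_category_simps T.AMap_Ident
        F.source.Ident_hom F.source.Comp_Ident_left[OF s(2)] F.source.Comp_Ident_right[OF s(2)])
  next
    fix f g a b c
    assume "f \<in> hom ?M a b" "g \<in> hom ?M b c"
    then show "Comp ?M g f \<in> hom ?M a c"
      unfolding hom_module_category
      by (elim exE conjE) (simp add: module_category_simps F.source.Comp_hom cp)
  next
    fix f a b assume "f \<in> hom ?M a b"
    then show "Comp ?M f (Ident ?M a) = f" "Comp ?M (Ident ?M b) f = f"
      unfolding hom_module_category
      by (elim exE conjE; simp add: module_category_simps F.source.Comp_Ident_left F.source.Comp_Ident_right)+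
  next
    fix f g h a b c d assume "f \<in> hom ?M a b" "g \<in> hom ?M b c" "h \<in> hom ?M c d"
    then show "Comp ?M h (Comp ?M g f) = Comp ?M (Comp ?M h g) f"
      unfolding hom_module_category
      by (elim exE conjE) (simp add: module_category_simps F.source.Comp_assoc)
  qed
  show ?thesis
  proof (intro is_functor.intro is_functor_axioms.intro cat F.source.category_axioms)
    fix a assume "a \<in> Obj ?M"
    then show "OMap forgetful a \<in> Obj A" "AMap forgetful (Ident ?M a) = Ident A (OMap forgetful a)"
      by (auto simp: module_category_simps forgetful_def modules_def)
  next
    fix f a b assume "f \<in> hom ?M a b"
    then show "AMap forgetful f \<in> hom A (OMap forgetful a) (OMap forgetful b)"
      by (auto simp: hom_module_category forgetful_def)
  next
    fix f g a b c assume "f \<in> hom ?M a b" "g \<in> hom ?M b c"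
    then show "AMap forgetful (Comp ?M g f) = Comp A (AMap forgetful g) (AMap forgetful f)"
      by (auto simp: hom_module_category module_category_simps forgetful_def)
  qed
qed

lemma module_full:
  "full_and_faithful (module_category A (induced_monad F G \<eta> \<epsilon>)) A forgetful \<longleftrightarrow>
    (\<forall>a \<in> Obj A. iso A (AMap G (\<epsilon> (OMap F a))))"
    (is "?L \<longleftrightarrow> ?R")
proof
  let ?T = "induced_monad F G \<eta> \<epsilon>"
  let ?M = "module_category A ?T"
  have GF: "is_functor A A (G \<odot> F)"
    using F.source.Comp_functor F.is_functor_axioms G.is_functor_axioms by blast
  interpret T: is_functor A A "Endo ?T" using GF by (simp add: induced_monad_def)
  note hM = hom_module_category
  {
    assume L: ?L
    show ?R
    proof
      fix a assume a: "a \<in> Obj A"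
      let ?K = "\<lambda>a. OMap G (OMap F a)" let ?m = "\<lambda>a. AMap G (\<epsilon> (OMap F a))"
      have Ta: "?K a \<in> Obj A" using a by (simp add: F.OMap_Obj G.OMap_Obj)
      have mh: "?m c \<in> hom A (?K (?K c)) (?K c)" if "c \<in> Obj A" for c
        using that by (intro G.AMap_hom counit_hom F.OMap_Obj)
      have free: "(?K c, ?m c) \<in> modules A ?T" if c: "c \<in> Obj A" for c
      proof -
        have e: "\<epsilon> (OMap F c) \<in> hom B (OMap F (?K c)) (OMap F c)"
          using c by (intro counit_hom F.OMap_Obj)
        have e': "\<epsilon> (OMap F (?K c)) \<in> hom B (OMap F (?K (?K c))) (OMap F (?K c))"
          using c by (intro counit_hom F.OMap_Obj G.OMap_Obj)
        have e'': "AMap F (AMap G (\<epsilon> (OMap F c))) \<in> hom B (OMap F (?K (?K c))) (OMap F (?K c))"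
          using mh[OF c] by (rule F.AMap_hom)
        show ?thesis
          using c mh[OF c] triangle_G[OF F.OMap_Obj[OF c]]
          by (simp add: modules_def induced_monad_def comp_functor_def F.OMap_Obj G.OMap_Obj
              G.AMap_Comp[OF e'' e, symmetric] G.AMap_Comp[OF e' e, symmetric] counit_nat[OF e])
      qed
      let ?x = "(?K a, ?m a)" and ?y = "(?K (?K a), ?m (?K a))"
      have "bij_betw (AMap forgetful) (hom ?M ?x ?y) (hom A (?K a) (?K (?K a)))"
        using L[unfolded full_and_faithful_def, THEN conjunct2, THEN bspec[of _ _ ?x], THEN bspec[of _ _ ?y]]
          free[OF a] free[OF Ta]
        by (simp add: module_category_simps forgetful_def[THEN arg_cong[of _ _ OMap]])
      then have "\<eta> (?K a) \<in> AMap forgetful ` hom ?M ?x ?y"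
        using unit_hom[OF Ta] by (simp add: bij_betw_def)
      then have "Comp A (\<eta> (?K a)) (?m a) = Comp A (?m (?K a)) (AMap G (AMap F (\<eta> (?K a))))"
        by (auto simp: hM forgetful_def induced_monad_def comp_functor_def)
      also have "\<dots> = Ident A (?K (?K a))"
        using Ta by (subst G.AMap_Comp[symmetric, OF F.AMap_hom[OF unit_hom[OF Ta]]
            counit_hom[OF F.OMap_Obj[OF Ta]]]) (simp add: triangle_F G.AMap_Ident F.OMap_Obj)
      finally show "iso A (?m a)"
        using isoI[OF mh[OF a] unit_hom[OF Ta]] triangle_G[OF F.OMap_Obj[OF a]] by simp
    qed
  next
    assume R: ?R
    have inv: "Comp A (\<eta> (fst x)) (snd x) = Ident A (OMap (Endo ?T) (fst x))"
      if x: "x \<in> modules A ?T" for x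
    proof -
      obtain a h where xx: "x = (a, h)" by fastforce
      have a: "a \<in> Obj A" and h: "h \<in> hom A (OMap G (OMap F a)) a" and e: "Comp A h (\<eta> a) = Ident A a"
        using x by (auto simp: xx modules_def induced_monad_def comp_functor_def)
      have u: "\<eta> a \<in> hom A a (OMap G (OMap F a))" using unit_hom[OF a] .
      let ?Ta = "OMap G (OMap F a)"
      have Ta: "?Ta \<in> Obj A" using a by (simp add: F.OMap_Obj G.OMap_Obj)
      have m: "AMap G (\<epsilon> (OMap F a)) \<in> hom A (OMap G (OMap F ?Ta)) ?Ta"
        using a by (intro G.AMap_hom counit_hom F.OMap_Obj)
      have h2: "AMap G (AMap F (\<eta> a)) \<in> hom A ?Ta (OMap G (OMap F ?Ta))"
        using a by (intro G.AMap_hom F.AMap_hom unit_hom)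
      have e1: "Comp A (AMap G (\<epsilon> (OMap F a))) (\<eta> ?Ta) = Ident A ?Ta"
        using triangle_G[OF F.OMap_Obj[OF a]] .
      have "Comp A (AMap G (\<epsilon> (OMap F a))) (AMap G (AMap F (\<eta> a))) = Ident A ?Ta"
        using a by (subst G.AMap_Comp[symmetric, OF F.AMap_hom[OF unit_hom[OF a]]
          counit_hom[OF F.OMap_Obj[OF a]]]) (simp add: triangle_F G.AMap_Ident F.OMap_Obj)
      then have eq: "\<eta> ?Ta = AMap G (AMap F (\<eta> a))"
        using F.source.inverse_unique[OF m unit_hom[OF Ta] h2]
          F.source.iso_section[OF m unit_hom[OF Ta] e1] R a by simp
      have "Comp A (\<eta> a) h = Comp A (AMap G (AMap F h)) (\<eta> ?Ta)" using unit_nat[OF h] .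
      also have "\<dots> = AMap G (AMap F (Comp A h (\<eta> a)))"
        unfolding eq F.AMap_Comp[OF u h] G.AMap_Comp[OF F.AMap_hom[OF u] F.AMap_hom[OF h]] ..
      also have "\<dots> = Ident A ?Ta"
        using a by (simp add: e F.AMap_Ident G.AMap_Ident F.OMap_Obj)
      finally show ?thesis by (simp add: xx induced_monad_def comp_functor_def)
    qed
    have lift: "Comp A f (snd x) = Comp A (snd y) (AMap (Endo ?T) f)"
      if x: "x \<in> modules A ?T" and y: "y \<in> modules A ?T" and f: "f \<in> hom A (fst x) (fst y)" for x y f
    proof -
      have hx: "snd x \<in> hom A (OMap (Endo ?T) (fst x)) (fst x)"
        and hy: "snd y \<in> hom A (OMap (Endo ?T) (fst y)) (fst y)"
        and ox: "fst x \<in> Obj A" and oy: "fst y \<in> Obj A"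
        and ey: "Comp A (snd y) (\<eta> (fst y)) = Ident A (fst y)"
        using x y by (auto simp: modules_def induced_monad_def)
      have ux: "\<eta> (fst x) \<in> hom A (fst x) (OMap (Endo ?T) (fst x))"
        and uy: "\<eta> (fst y) \<in> hom A (fst y) (OMap (Endo ?T) (fst y))"
        using unit_hom ox oy by (simp_all add: induced_monad_def comp_functor_def)
      note Tf = T.AMap_hom[OF f]
      have fx: "Comp A f (snd x) \<in> hom A (OMap (Endo ?T) (fst x)) (fst y)"
        using F.source.Comp_hom[OF hx f] .
      have "Comp A (snd y) (AMap (Endo ?T) f)
          = Comp A (snd y) (Comp A (AMap (Endo ?T) f) (Comp A (\<eta> (fst x)) (snd x)))"
        using F.source.Comp_Ident_right[OF Tf] inv[OF x] by simp
      also have "\<dots> = Comp A (snd y) (Comp A (Comp A (AMap (Endo ?T) f) (\<eta> (fst x))) (snd x))"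
        using F.source.Comp_assoc[OF hx ux Tf] by simp
      also have "Comp A (AMap (Endo ?T) f) (\<eta> (fst x)) = Comp A (\<eta> (fst y)) f"
        using unit_nat[OF f] by (simp add: induced_monad_def comp_functor_def)
      also have "Comp A (snd y) (Comp A (Comp A (\<eta> (fst y)) f) (snd x))
          = Comp A (Comp A (snd y) (\<eta> (fst y))) (Comp A f (snd x))"
        using F.source.Comp_assoc[OF hx f uy] F.source.Comp_assoc[OF fx uy hy] by simp
      also have "\<dots> = Comp A f (snd x)"
        using F.source.Comp_Ident_left[OF fx] ey by simp
      finally show ?thesis ..
    qed
    show ?L
      unfolding full_and_faithful_def
    proof (intro conjI ballI module_functor)
      fix x y assume "x \<in> Obj ?M" "y \<in> Obj ?M"
      then have xy: "x \<in> modules A ?T" "y \<in> modules A ?T" by (simp_all add: module_category_simps)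
      have "AMap forgetful ` hom ?M x y = hom A (fst x) (fst y)"
        using xy lift[OF xy] by (force simp: hM forgetful_def image_iff)
      then show "bij_betw (AMap forgetful) (hom ?M x y) (hom A (OMap forgetful x) (OMap forgetful y))"
        by (auto simp: bij_betw_def inj_on_def hM forgetful_def)
    qed
  }
qed

end


lemma comodule_category_simps:
  "Obj (comodule_category C W) = comodules C W"
  "Ident (comodule_category C W) x = (x, x, Ident C (fst x))"
  "Comp (comodule_category C W) (y, z, g) (x, y', f) = (x, z, Comp C g f)"
  "Dom (comodule_category C W) (x, y, f) = x"
  "Cod (comodule_category C W) (x, y, f) = y"
  by (simp_all add: comodule_category_def)

lemma hom_comodule_category: "p \<in> hom (comodule_category C W) x y \<longleftrightarrow>
    (\<exists>f. p = (x, y, f) \<and> x \<in> comodules C W \<and> y \<in> comodules C W \<and> f \<in> hom C (fst x) (fst y) \<and>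
      Comp C (snd y) f = Comp C (AMap (Coendo W) f) (snd x))"
  unfolding hom_def[of "comodule_category C W"]
  by (cases p) (auto simp: comodule_category_def)

lemma modules_dual:
  "modules (dual B) (induced_monad G F \<epsilon> \<eta>) = comodules B (induced_comonad F G \<eta> \<epsilon>)"
  by (simp add: modules_def comodules_def induced_monad_def induced_comonad_def)

definition swap3 :: "'a \<times> 'a \<times> 'b \<Rightarrow> 'a \<times> 'a \<times> 'b" where
  "swap3 = (\<lambda>(x, y, f). (y, x, f))"

lemma swap3_hom: "p \<in> hom (module_category (dual B) (induced_monad G F \<epsilon> \<eta>)) y x \<longleftrightarrow>
    swap3 p \<in> hom (comodule_category B (induced_comonad F G \<eta> \<epsilon>)) x y"
  unfolding hom_module_category hom_comodule_category modules_dual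
  by (cases p) (auto simp: swap3_def induced_monad_def induced_comonad_def)

lemma swap3_swap3 [simp]: "swap3 (swap3 p) = p"
  by (cases p) (simp add: swap3_def)

lemma swap3_Comp: "Comp (comodule_category B W) q p =
    swap3 (Comp (module_category C T) (swap3 p) (swap3 q))" if "C = dual B"
  unfolding that
  by (cases p; cases q) (simp add: comodule_category_simps module_category_simps swap3_def)

lemma forgetful_swap3: "AMap forgetful (swap3 p) = AMap forgetful p"
  by (cases p) (simp add: swap3_def forgetful_def)

context adjunction
begin

lemma comodule_full:
  "full_and_faithful (comodule_category B (induced_comonad F G \<eta> \<epsilon>)) B forgetful \<longleftrightarrow>
    (\<forall>b \<in> Obj B. iso B (AMap F (\<eta> (OMap G b))))"
proof -
  interpret d: adjunction "dual B" "dual A" G F \<epsilon> \<eta>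
    using adjunction_dual adjunction_axioms .
  let ?W = "comodule_category B (induced_comonad F G \<eta> \<epsilon>)"
  let ?M = "module_category (dual B) (induced_monad G F \<epsilon> \<eta>)"
  let ?U = "forgetful :: ('p \<times> 'n, ('p \<times> 'n) \<times> ('p \<times> 'n) \<times> 'n, 'p, 'n) func"
  interpret U: is_functor ?M "dual B" ?U by (rule d.module_functor)
  have obj: "Obj ?W = Obj ?M"
    by (simp add: module_category_simps comodule_category_simps modules_dual)
  have h: "p \<in> hom ?W x y \<longleftrightarrow> swap3 p \<in> hom ?M y x" for p x y
    by (simp add: swap3_hom)
  have I: "Ident ?W x = swap3 (Ident ?M x)" for x
    by (simp add: module_category_simps comodule_category_simps swap3_def)
  note C = swap3_Comp[OF refl, of B "induced_comonad F G \<eta> \<epsilon>" _ _ "induced_monad G F \<epsilon> \<eta>"]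
  have arr: "Dom ?W p = Cod ?M (swap3 p) \<and> Cod ?W p = Dom ?M (swap3 p)" for p
    by (cases p) (simp add: module_category_simps comodule_category_simps swap3_def)
  have "category ?W"
  proof
    fix p assume "p \<in> Arr ?W"
    then have "p \<in> hom ?W (Dom ?W p) (Cod ?W p)" by (rule homI)
    then have "swap3 p \<in> Arr ?M" unfolding h by (simp add: hom_def[of ?M])
    then show "Dom ?W p \<in> Obj ?W" "Cod ?W p \<in> Obj ?W"
      using arr[of p] by (simp_all add: obj U.source.Dom_Obj U.source.Cod_Obj)
  next
    fix a assume "a \<in> Obj ?W"
    then show "Ident ?W a \<in> hom ?W a a" by (simp add: h I obj U.source.Ident_hom)
  next
    fix f g a b c assume "f \<in> hom ?W a b" "g \<in> hom ?W b c"
    then show "Comp ?W g f \<in> hom ?W a c" unfolding h C swap3_swap3 by (rule U.source.Comp_hom[rotated])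
  next
    fix f a b assume "f \<in> hom ?W a b"
    then show "Comp ?W f (Ident ?W a) = f" "Comp ?W (Ident ?W b) f = f"
      unfolding h C I swap3_swap3
      by (simp_all add: U.source.Comp_Ident_left U.source.Comp_Ident_right)
  next
    fix f g k a b c d assume "f \<in> hom ?W a b" "g \<in> hom ?W b c" "k \<in> hom ?W c d"
    then show "Comp ?W k (Comp ?W g f) = Comp ?W (Comp ?W k g) f"
      unfolding h C swap3_swap3 using U.source.Comp_assoc by metis
  qed
  moreover have "is_functor_axioms ?W B ?U"
  proof
    fix a assume a: "a \<in> Obj ?W"
    show "OMap ?U a \<in> Obj B" using U.OMap_Obj a by (simp add: obj)
    show "AMap ?U (Ident ?W a) = Ident B (OMap ?U a)"
      using U.AMap_Ident a by (simp add: obj I forgetful_swap3)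
  next
    fix f a b assume "f \<in> hom ?W a b"
    then show "AMap ?U f \<in> hom B (OMap ?U a) (OMap ?U b)"
      unfolding h using U.AMap_hom[of "swap3 f" b a] by (simp add: forgetful_swap3)
  next
    fix f g a b c assume "f \<in> hom ?W a b" "g \<in> hom ?W b c"
    then show "AMap ?U (Comp ?W g f) = Comp B (AMap ?U g) (AMap ?U f)"
      unfolding h C using U.AMap_Comp[of "swap3 g" c b "swap3 f" a] by (simp add: forgetful_swap3)
  qed
  ultimately have fW: "is_functor ?W B ?U"
    using F.target.category_axioms by (simp add: is_functor_def)
  have "bij_betw (AMap ?U) (hom ?W x y) (hom B (OMap ?U x) (OMap ?U y)) \<longleftrightarrow>
      bij_betw (AMap ?U) (hom ?M y x) (hom (dual B) (OMap ?U y) (OMap ?U x))" for x y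
  proof -
    have im: "hom ?M y x = swap3 ` hom ?W x y"
      unfolding set_eq_iff image_iff Bex_def h by (metis swap3_swap3)
    have s: "bij_betw swap3 (hom ?W x y) (hom ?M y x)"
      unfolding im by (rule inj_on_imp_bij_betw) (metis inj_onI swap3_swap3)
    have "AMap ?U \<circ> swap3 = AMap ?U"
      using forgetful_swap3 by fastforce
    then show ?thesis
      using bij_betw_comp_iff[OF s, of "AMap ?U" "hom B (OMap ?U x) (OMap ?U y)"] by simp
  qed
  then have "full_and_faithful ?W B ?U \<longleftrightarrow> full_and_faithful ?M (dual B) ?U"
    using fW U.is_functor_axioms unfolding full_and_faithful_def obj by blast
  then show ?thesis
    using d.module_full by simp
qed

lemma idempotent_conditions:
  defines "c1 \<equiv> natural_isomorphism A B (F \<odot> G \<odot> F) F (\<lambda>a. \<epsilon> (OMap F a))"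
    and "c2 \<equiv> natural_isomorphism B A G (G \<odot> F \<odot> G) (\<lambda>b. \<eta> (OMap G b))"
    and "c3 \<equiv> natural_isomorphism A A (G \<odot> F \<odot> G \<odot> F) (G \<odot> F) (\<lambda>a. AMap G (\<epsilon> (OMap F a)))"
    and "c4 \<equiv> natural_isomorphism B B (F \<odot> G) (F \<odot> G \<odot> F \<odot> G) (\<lambda>b. AMap F (\<eta> (OMap G b)))"
    and "c5 \<equiv> full_and_faithful (module_category A (induced_monad F G \<eta> \<epsilon>)) A forgetful"
    and "c6 \<equiv> full_and_faithful (comodule_category B (induced_comonad F G \<eta> \<epsilon>)) B forgetful"
  shows "c2 \<longleftrightarrow> c1" "c3 \<longleftrightarrow> c1" "c4 \<longleftrightarrow> c1" "c5 \<longleftrightarrow> c1" "c6 \<longleftrightarrow> c1"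
proof -
  interpret d: adjunction "dual B" "dual A" G F \<epsilon> \<eta>
    using adjunction_dual adjunction_axioms .
  note fs = F.is_functor_axioms G.is_functor_axioms
  have f: "is_functor A A (G \<odot> F)" "is_functor B B (F \<odot> G)"
    using F.source.Comp_functor F.target.Comp_functor fs by blast+
  have f3: "is_functor A B (F \<odot> G \<odot> F)" "is_functor B A (G \<odot> F \<odot> G)"
    using F.source.Comp_functor[OF f(1) fs(1)] F.target.Comp_functor[OF f(2) fs(2)] by auto
  have f4: "is_functor A A (G \<odot> F \<odot> G \<odot> F)" "is_functor B B (F \<odot> G \<odot> F \<odot> G)"
    using F.source.Comp_functor[OF f3(1) fs(2)] F.target.Comp_functor[OF f3(2) fs(1)] by auto
  have c1: "c1 \<longleftrightarrow> (\<forall>a \<in> Obj A. iso B (\<epsilon> (OMap F a)))"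
    unfolding c1_def natural_isomorphism_def natural_transformation_def
      natural_isomorphism_axioms_def natural_transformation_axioms_def
    using f3(1) fs(1) counit_hom[OF F.OMap_Obj] counit_nat[OF F.AMap_hom]
    by (auto simp: comp_functor_def)
  have c2: "c2 \<longleftrightarrow> (\<forall>b \<in> Obj B. iso A (\<eta> (OMap G b)))"
    unfolding c2_def natural_isomorphism_def natural_transformation_def
      natural_isomorphism_axioms_def natural_transformation_axioms_def
    using f3(2) fs(2) unit_hom[OF G.OMap_Obj] unit_nat[OF G.AMap_hom]
    by (auto simp: comp_functor_def)
  have n3: "Comp A (AMap G (\<epsilon> (OMap F b))) (AMap G (AMap F (AMap G (AMap F f)))) =
      Comp A (AMap G (AMap F f)) (AMap G (\<epsilon> (OMap F a)))" if g: "f \<in> hom A a b" for f a b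
  proof -
    have o: "OMap F a \<in> Obj B" "OMap F b \<in> Obj B"
      using g F.source.Dom_Obj F.source.Cod_Obj by (auto simp: hom_def intro: F.OMap_Obj)
    note Ff = F.AMap_hom[OF g]
    show ?thesis
      using G.AMap_Comp[OF F.AMap_hom[OF G.AMap_hom[OF Ff]] counit_hom[OF o(2)]]
        G.AMap_Comp[OF counit_hom[OF o(1)] Ff] counit_nat[OF Ff] by simp
  qed
  have n4: "Comp B (AMap F (\<eta> (OMap G b))) (AMap F (AMap G f)) =
      Comp B (AMap F (AMap G (AMap F (AMap G f)))) (AMap F (\<eta> (OMap G a)))" if g: "f \<in> hom B a b" for f a b
  proof -
    have o: "OMap G a \<in> Obj A" "OMap G b \<in> Obj A"
      using g F.target.Dom_Obj F.target.Cod_Obj by (auto simp: hom_def intro: G.OMap_Obj)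
    note Gf = G.AMap_hom[OF g]
    show ?thesis
      using F.AMap_Comp[OF Gf unit_hom[OF o(2)]]
        F.AMap_Comp[OF unit_hom[OF o(1)] G.AMap_hom[OF F.AMap_hom[OF Gf]]] unit_nat[OF Gf] by simp
  qed
  have c3: "c3 \<longleftrightarrow> (\<forall>a \<in> Obj A. iso A (AMap G (\<epsilon> (OMap F a))))"
    unfolding c3_def natural_isomorphism_def natural_transformation_def
      natural_isomorphism_axioms_def natural_transformation_axioms_def
    using f4(1) f(1) G.AMap_hom[OF counit_hom[OF F.OMap_Obj]] n3
    by (auto simp: comp_functor_def)
  have c4: "c4 \<longleftrightarrow> (\<forall>b \<in> Obj B. iso B (AMap F (\<eta> (OMap G b))))"
    unfolding c4_def natural_isomorphism_def natural_transformation_def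
      natural_isomorphism_axioms_def natural_transformation_axioms_def
    using f4(2) f(2) F.AMap_hom[OF unit_hom[OF G.OMap_Obj]] n4
    by (auto simp: comp_functor_def)
  have 13: "c1 \<Longrightarrow> c3" unfolding c1 c3 using G.AMap_iso by blast
  have 32: "c3 \<Longrightarrow> c2" unfolding c3 c2 using unit_G_iso by blast
  have 24: "c2 \<Longrightarrow> c4" unfolding c2 c4 using F.AMap_iso by blast
  have 41: "c4 \<Longrightarrow> c1" unfolding c4 c1 using d.unit_G_iso by simp
  show "c2 \<longleftrightarrow> c1" "c3 \<longleftrightarrow> c1" "c4 \<longleftrightarrow> c1" using 13 32 24 41 by blast+
  then show "c5 \<longleftrightarrow> c1" "c6 \<longleftrightarrow> c1"
    unfolding c5_def c6_def module_full comodule_full c3[symmetric] c4[symmetric] by simp_all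
qed

end

end

theory Submission
  imports Defs
begin

text \<open>
  Everything rests on one consequence of idempotency: \<open>\<eta>\<close> is invertible on every object of the
  form \<open>Gb\<close>, so \<open>\<eta>\<^bsub>GFa\<^esub>\<close> and \<open>GF\<eta>\<^bsub>a\<^esub>\<close>, both being sections of the now invertible
  multiplication \<open>G\<epsilon>F\<^bsub>a\<^esub>\<close>, are equal (lemma \<open>unit_GF_eq\<close>).  Naturality then shows that a
  retraction \<open>h\<close> of \<open>\<eta>\<^bsub>a\<^esub>\<close> is a two-sided inverse, because
  \<open>\<eta>\<^bsub>a\<^esub> h = GFh \<cdot> \<eta>\<^bsub>GFa\<^esub> = GF(h \<eta>\<^bsub>a\<^esub>)\<close>.

  Hence a module structure on \<open>a\<close> exists only if \<open>\<eta>\<^bsub>a\<^esub>\<close> is invertible, and then it is the inverse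
  (\<open>modules_eq\<close>).  The forgetful functor, which is full and faithful, is therefore bijective on
  objects over the fixed objects: it is an isomorphism onto \<open>Fix\<close>, not only an equivalence.  The
  reflection of \<open>A\<close> onto \<open>Fix\<close> has unit \<open>\<eta>\<close> and counit \<open>\<eta>\<^sup>-\<^sup>1\<close> (\<open>Fix_reflective\<close>).  The hypotheses are
  self-dual (\<open>dual_idempotent\<close>), which gives the statements about comodules, and the equivalence
  between the two subcategories of fixed objects has the restrictions of \<open>\<eta>\<close> and \<open>\<epsilon>\<close> as its
  natural isomorphisms (\<open>Fix_equivalence\<close>).

  For the category of fractions, \<open>F\<close> inverts each \<open>\<eta>\<^bsub>b\<^esub>\<close>, so a Kleisli arrow \<open>f : a \<rightarrow> GFb\<close> yields
  the path that follows \<open>f\<close> and then \<open>\<eta>\<^bsub>b\<^esub>\<close> backwards.  Every path is congruent to one of these: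
  an object \<open>GFb\<close> is local, that is, each arrow into it extends along every arrow inverted by \<open>F\<close>
  (\<open>extend_along_inverted\<close>), so backward edges can be absorbed one at a time from the end of the
  path (\<open>path_eq_roof\<close>).  The Kleisli arrow is determined by the path, because evaluating the path in
  \<open>B\<close> along \<open>F\<close> gives the adjoint transpose of \<open>f\<close> (\<open>path_value_roof\<close>).
\<close>

section \<open>Isomorphisms and their inverses\<close>

definition inverse_arrow :: "('o, 'm) cat \<Rightarrow> 'm \<Rightarrow> 'm" where
  "inverse_arrow C f = (SOME g. g \<in> hom C (Cod C f) (Dom C f) \<and>
     Comp C g f = Ident C (Dom C f) \<and> Comp C f g = Ident C (Cod C f))"

lemma inverse_arrow:
  assumes "iso C f" "f \<in> hom C a b"
  shows "inverse_arrow C f \<in> hom C b a"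
    and "Comp C (inverse_arrow C f) f = Ident C a"
    and "Comp C f (inverse_arrow C f) = Ident C b"
proof -
  have "inverse_arrow C f \<in> hom C (Cod C f) (Dom C f) \<and>
      Comp C (inverse_arrow C f) f = Ident C (Dom C f) \<and>
      Comp C f (inverse_arrow C f) = Ident C (Cod C f)"
    unfolding inverse_arrow_def by (rule someI_ex) (use assms(1) in \<open>auto simp: iso_def\<close>)
  then show "inverse_arrow C f \<in> hom C b a" "Comp C (inverse_arrow C f) f = Ident C a"
    "Comp C f (inverse_arrow C f) = Ident C b"
    using assms(2) by (auto simp: hom_def)
qed

context category
begin

lemma hom_Obj: "f \<in> hom C a b \<Longrightarrow> a \<in> Obj C" "f \<in> hom C a b \<Longrightarrow> b \<in> Obj C"
  using Dom_Obj Cod_Obj by (auto simp: hom_def)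

lemma inverse_arrow_eq:
  assumes "f \<in> hom C a b" "g \<in> hom C b a" "Comp C g f = Ident C a" "Comp C f g = Ident C b"
  shows "inverse_arrow C f = g"
  using inverse_unique[OF assms(1) _ assms(2) _ assms(4)] inverse_arrow[OF isoI[OF assms] assms(1)]
  by blast

lemma inverse_arrow_iso: "iso C f \<Longrightarrow> f \<in> hom C a b \<Longrightarrow> iso C (inverse_arrow C f)"
  by (rule isoI[of _ _ b a f]) (simp_all add: inverse_arrow)

lemma iso_Ident: "a \<in> Obj C \<Longrightarrow> iso C (Ident C a)"
  by (rule isoI[OF Ident_hom Ident_hom]) (simp_all add: Comp_Ident_left[OF Ident_hom])

lemma iso_Comp:
  assumes f: "f \<in> hom C a b" "iso C f" and g: "g \<in> hom C b c" "iso C g"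
  shows "iso C (Comp C g f)"
proof -
  let ?f = "inverse_arrow C f" and ?g = "inverse_arrow C g"
  note F = inverse_arrow[OF f(2,1)] and G = inverse_arrow[OF g(2,1)]
  have "Comp C (Comp C ?f ?g) (Comp C g f) = Comp C ?f (Comp C (Comp C ?g g) f)"
    using Comp_assoc[OF Comp_hom[OF f(1) g(1)] G(1) F(1)] Comp_assoc[OF f(1) g(1) G(1)] by simp
  then have l: "Comp C (Comp C ?f ?g) (Comp C g f) = Ident C a"
    using F G Comp_Ident_left[OF f(1)] by simp
  have "Comp C (Comp C g f) (Comp C ?f ?g) = Comp C g (Comp C (Comp C f ?f) ?g)"
    using Comp_assoc[OF Comp_hom[OF G(1) F(1)] f(1) g(1)] Comp_assoc[OF G(1) F(1) f(1)] by simp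
  then have r: "Comp C (Comp C g f) (Comp C ?f ?g) = Ident C c"
    using F G Comp_Ident_left[OF G(1)] by simp
  show ?thesis by (rule isoI[OF Comp_hom[OF f(1) g(1)] Comp_hom[OF G(1) F(1)] l r])
qed

lemma iso_cancel_right:
  assumes f: "f \<in> hom C a b" "iso C f" and g: "g \<in> hom C b c" and i: "iso C (Comp C g f)"
  shows "iso C g"
proof -
  note F = inverse_arrow[OF f(2,1)]
  have "Comp C (Comp C g f) (inverse_arrow C f) = g"
    using Comp_assoc[OF F(1) f(1) g] F Comp_Ident_right[OF g] by simp
  then show ?thesis
    using iso_Comp[OF F(1) inverse_arrow_iso[OF f(2,1)] Comp_hom[OF f(1) g] i] by simp
qed

lemma iso_cancel_left:
  assumes f: "f \<in> hom C a b" and g: "g \<in> hom C b c" "iso C g" and i: "iso C (Comp C g f)"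
  shows "iso C f"
  using category.iso_cancel_right[OF category_dual[OF category_axioms], of g c b f a] assms by simp

end

lemma isomorphic_objects_sym: "isomorphic_objects C a b \<Longrightarrow> isomorphic_objects C b a"
  unfolding isomorphic_objects_def by (metis isoE isoI)

section \<open>Full subcategories\<close>

lemma full_subcategory_simps [simp]:
  "Obj (full_subcategory C X) = X" "Dom (full_subcategory C X) = Dom C"
  "Cod (full_subcategory C X) = Cod C" "Ident (full_subcategory C X) = Ident C"
  "Comp (full_subcategory C X) = Comp C"
  by (simp_all add: full_subcategory_def)

lemma hom_full_subcategory [simp]:
  "f \<in> hom (full_subcategory C X) a b \<longleftrightarrow> a \<in> X \<and> b \<in> X \<and> f \<in> hom C a b"
  by (auto simp: hom_def full_subcategory_def)

lemma iso_full_subcategory: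
  "f \<in> hom C a b \<Longrightarrow> a \<in> X \<Longrightarrow> b \<in> X \<Longrightarrow> iso (full_subcategory C X) f \<longleftrightarrow> iso C f"
  by (auto simp: iso_def) (auto simp: hom_def full_subcategory_def)

lemma full_subcategory_Obj: "category C \<Longrightarrow> full_subcategory C (Obj C) = C"
proof -
  assume "category C"
  then interpret category C .
  have "{f \<in> Arr C. Dom C f \<in> Obj C \<and> Cod C f \<in> Obj C} = Arr C"
    using Dom_Obj Cod_Obj by blast
  then show ?thesis by (simp add: full_subcategory_def)
qed

lemma category_full_subcategory: "category C \<Longrightarrow> X \<subseteq> Obj C \<Longrightarrow> category (full_subcategory C X)"
proof -
  assume "category C" and X: "X \<subseteq> Obj C"
  then interpret category C by simp
  show ?thesis
    by (rule category.intro)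
      (use X in \<open>auto simp: Ident_hom Comp_hom Comp_Ident_left Comp_Ident_right Comp_assoc
        full_subcategory_def[THEN arg_cong[of _ _ Arr]]\<close>)
qed

lemma functor_full_subcategory:
  assumes "is_functor C D F" "X \<subseteq> Obj C" "Y \<subseteq> Obj D" "\<And>a. a \<in> X \<Longrightarrow> OMap F a \<in> Y"
  shows "is_functor (full_subcategory C X) (full_subcategory D Y) F"
proof -
  interpret is_functor C D F by fact
  show ?thesis
    by (intro is_functor.intro is_functor_axioms.intro category_full_subcategory
        source.category_axioms target.category_axioms assms(2,3))
      (use assms(2-) in \<open>auto simp: AMap_hom AMap_Ident AMap_Comp\<close>)
qed

lemma functor_id: "category C \<Longrightarrow> is_functor C C id_functor"
  by (auto simp: is_functor_def is_functor_axioms_def id_functor_def)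

lemma subcategory_full: "category C \<Longrightarrow> X \<subseteq> Obj C \<Longrightarrow> subcategory (full_subcategory C X) C"
  using functor_full_subcategory[OF functor_id, of C X "Obj C"]
  by (auto simp: subcategory_def full_subcategory_Obj id_functor_def)

lemma natural_isomorphism_full_subcategory:
  assumes "natural_transformation C D F G t"
    and "is_functor (full_subcategory C X) (full_subcategory D Y) F"
    and "is_functor (full_subcategory C X) (full_subcategory D Y) G"
    and X: "X \<subseteq> Obj C" and i: "\<And>a. a \<in> X \<Longrightarrow> iso D (t a)"
  shows "natural_isomorphism (full_subcategory C X) (full_subcategory D Y) F G t"
proof -
  interpret natural_transformation C D F G t by fact
  interpret F': is_functor "full_subcategory C X" "full_subcategory D Y" F by fact
  interpret G': is_functor "full_subcategory C X" "full_subcategory D Y" G by fact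
  show ?thesis
  proof
    fix a assume "a \<in> Obj (full_subcategory C X)"
    then have a: "a \<in> X" "OMap F a \<in> Y" "OMap G a \<in> Y"
      using F'.OMap_Obj G'.OMap_Obj by auto
    then have h: "t a \<in> hom D (OMap F a) (OMap G a)" using component_hom X by blast
    show "t a \<in> hom (full_subcategory D Y) (OMap F a) (OMap G a)" using a h by simp
    show "iso (full_subcategory D Y) (t a)" using iso_full_subcategory[OF h a(2,3)] i a by simp
  qed (simp add: naturality)
qed

lemma full_and_faithful_full_subcategory:
  assumes "full_and_faithful C D F" "X \<subseteq> Obj D" "\<And>a. a \<in> Obj C \<Longrightarrow> OMap F a \<in> X"
  shows "full_and_faithful C (full_subcategory D X) F"
proof -
  interpret is_functor C D F using assms(1) by (simp add: full_and_faithful_def)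
  have "is_functor C (full_subcategory D X) F"
    using functor_full_subcategory[OF is_functor_axioms subset_refl assms(2,3)]
    by (simp add: full_subcategory_Obj source.category_axioms)
  moreover have "hom (full_subcategory D X) (OMap F a) (OMap F b) = hom D (OMap F a) (OMap F b)"
    if "a \<in> Obj C" "b \<in> Obj C" for a b
    using assms(3) that by (simp add: set_eq_iff)
  ultimately show ?thesis using assms(1) by (simp add: full_and_faithful_def)
qed

section \<open>Duality\<close>

lemma full_subcategory_dual: "full_subcategory (dual C) X = dual (full_subcategory C X)"
  by (simp add: full_subcategory_def dual_def conj_commute)

lemma dual_dual [simp]: "dual (dual C) = C"
  by (simp add: dual_def)

text \<open>The adjunction that exhibits a reflection of the dual categories turns, under dualization, into one
  with the inclusion on the left.\<close>

lemma coreflective_if_dual_reflective: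
  "reflective_subcategory (dual C) (dual D) R \<Longrightarrow> coreflective_subcategory C D R"
  using adjunction_dual[of "dual C" "dual D" R id_functor]
    functor_dual[of "dual D" "dual C" id_functor]
  by (auto simp: reflective_subcategory_def coreflective_subcategory_def subcategory_def)

lemma Fix_dual: "Fix (dual C) t = dual (Fix C t)"
  by (simp add: Fix_def full_subcategory_dual)

lemma image_closure_dual: "image_closure (dual C) T = dual (image_closure C T)"
proof -
  have "isomorphic_objects (dual C) a b \<longleftrightarrow> isomorphic_objects C a b" for a b
    using isomorphic_objects_sym[of C] by (auto simp: isomorphic_objects_def)
  then show ?thesis by (simp add: image_closure_def full_subcategory_dual)
qed

section \<open>Functors that are isomorphisms of categories\<close>

lemma functor_eq_natural_isomorphism:
  assumes "is_functor C D F" "is_functor C D G" "functor_eq C F G"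
  shows "natural_isomorphism C D F G (\<lambda>a. Ident D (OMap F a))"
proof -
  interpret F: is_functor C D F by fact
  interpret G: is_functor C D G by fact
  show ?thesis
  proof
    fix a assume a: "a \<in> Obj C"
    then show "Ident D (OMap F a) \<in> hom D (OMap F a) (OMap G a)"
      using assms(3) F.target.Ident_hom[OF F.OMap_Obj] by (simp add: functor_eq_def)
    show "iso D (Ident D (OMap F a))" using a F.target.iso_Ident F.OMap_Obj by blast
  next
    fix f a b assume f: "f \<in> hom C a b"
    then have "AMap F f = AMap G f" using assms(3) by (simp add: functor_eq_def hom_def)
    then show "Comp D (Ident D (OMap F b)) (AMap F f) = Comp D (AMap G f) (Ident D (OMap F a))"
      using F.AMap_hom[OF f] F.target.Comp_Ident_left F.target.Comp_Ident_right by metis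
  qed
qed

lemma category_isomorphism_equivalence: "category_isomorphism C D F \<Longrightarrow> is_equivalence C D F"
proof -
  assume "category_isomorphism C D F"
  then obtain G where F: "is_functor C D F" and G: "is_functor D C G"
    and e: "functor_eq C (G \<odot> F) id_functor" "functor_eq D (F \<odot> G) id_functor"
    by (auto simp: category_isomorphism_def)
  interpret F: is_functor C D F by fact
  have "functor_eq C id_functor (G \<odot> F)" using e(1) by (simp add: functor_eq_def)
  then show ?thesis
    using F G functor_eq_natural_isomorphism[OF F.target.Comp_functor[OF G F]]
      functor_eq_natural_isomorphism[OF functor_id F.source.Comp_functor[OF F G]] e(2)
      F.source.category_axioms F.target.category_axioms functor_id
    unfolding is_equivalence_def inverse_equivalences_def by meson
qed

text \<open>Both the comparison of modules with fixed objects and that of Kleisli arrows with fractions come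
  down to a functor that is bijective on objects and on each hom-set.  This lemma spares them the
  construction of an inverse functor.\<close>

lemma full_and_faithful_isomorphism:
  assumes "full_and_faithful C D F" and o: "bij_betw (OMap F) (Obj C) (Obj D)"
  shows "category_isomorphism C D F"
proof -
  interpret is_functor C D F using assms(1) by (simp add: full_and_faithful_def)
  have h: "bij_betw (AMap F) (hom C a b) (hom D (OMap F a) (OMap F b))"
    if "a \<in> Obj C" "b \<in> Obj C" for a b
    using assms(1) that by (simp add: full_and_faithful_def)
  define i where "i = inv_into (Obj C) (OMap F)"
  define j where "j g = inv_into (hom C (i (Dom D g)) (i (Cod D g))) (AMap F) g" for g
  have i: "i x \<in> Obj C" "OMap F (i x) = x" if "x \<in> Obj D" for x
    using that o by (auto simp: i_def bij_betw_def inv_into_into f_inv_into_f)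
  have iF: "i (OMap F a) = a" if "a \<in> Obj C" for a
    using that o by (simp add: i_def bij_betw_def)
  have j: "j g \<in> hom C (i x) (i y)" "AMap F (j g) = g" if g: "g \<in> hom D x y" for g x y
  proof -
    have xy: "x \<in> Obj D" "y \<in> Obj D" using g target.hom_Obj by blast+
    have "g \<in> AMap F ` hom C (i x) (i y)"
      using h[OF i(1) i(1), of x y] xy g i(2) by (simp add: bij_betw_def)
    then show "j g \<in> hom C (i x) (i y)" "AMap F (j g) = g"
      using g unfolding j_def hom_def[of D] by (auto intro: inv_into_into f_inv_into_f)
  qed
  have u: "f = f'" if "f \<in> hom C a b" "f' \<in> hom C a b" "AMap F f = AMap F f'" for f f' a b
    using h[of a b] source.hom_Obj[OF that(1)] that by (auto simp: bij_betw_def inj_on_def)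
  let ?G = "\<lparr>OMap = i, AMap = j\<rparr>"
  have "is_functor D C ?G"
  proof
    fix x assume x: "x \<in> Obj D"
    then show "OMap ?G x \<in> Obj C" using i by simp
    show "AMap ?G (Ident D x) = Ident C (OMap ?G x)"
      using u[OF j(1)[OF target.Ident_hom[OF x]] source.Ident_hom[OF i(1)[OF x]]]
        j(2)[OF target.Ident_hom[OF x]] i x by (simp add: AMap_Ident)
  next
    fix f x y assume "f \<in> hom D x y"
    then show "AMap ?G f \<in> hom C (OMap ?G x) (OMap ?G y)" using j by simp
  next
    fix f g x y z assume f: "f \<in> hom D x y" and g: "g \<in> hom D y z"
    note J = j[OF f] j[OF g] j[OF target.Comp_hom[OF f g]]
    show "AMap ?G (Comp D g f) = Comp C (AMap ?G g) (AMap ?G f)"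
      using u[OF J(5) source.Comp_hom[OF J(1,3)]] AMap_Comp[OF J(1,3)] J by simp
  qed
  moreover have "functor_eq C (?G \<odot> F) id_functor"
    unfolding functor_eq_def
  proof (intro conjI ballI)
    fix f assume "f \<in> Arr C"
    then have f: "f \<in> hom C (Dom C f) (Cod C f)" by (rule homI)
    then show "AMap (?G \<odot> F) f = AMap id_functor f"
      using u[OF _ f] j[OF AMap_hom[OF f]] source.hom_Obj[OF f]
      by (simp add: comp_functor_def id_functor_def iF)
  qed (simp add: comp_functor_def id_functor_def iF)
  moreover have "functor_eq D (F \<odot> ?G) id_functor"
    using j(2)[OF homI] i(2) by (simp add: functor_eq_def comp_functor_def id_functor_def)
  ultimately show ?thesis
    using is_functor_axioms by (auto simp: category_isomorphism_def)
qed

section \<open>Idempotent adjunctions and their fixed objects\<close>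

locale idempotent_adjunction = adjunction A B F G \<eta> \<epsilon>
  for A :: "('o, 'm) cat" and B :: "('p, 'n) cat"
    and F :: "('o, 'm, 'p, 'n) func" and G :: "('p, 'n, 'o, 'm) func"
    and \<eta> :: "'o \<Rightarrow> 'm" and \<epsilon> :: "'p \<Rightarrow> 'n" +
  assumes counit_F_iso: "a \<in> Obj A \<Longrightarrow> iso B (\<epsilon> (OMap F a))"
begin

lemma unit_G_isomorphism: "b \<in> Obj B \<Longrightarrow> iso A (\<eta> (OMap G b))"
  using unit_G_iso G.AMap_iso counit_F_iso by blast

text \<open>Passing to duals exchanges \<open>F\<close> with \<open>G\<close> and \<open>\<eta>\<close> with \<open>\<epsilon>\<close>; the required invertibility is the one
  of \<open>\<eta>G\<close>.\<close>

lemma dual_idempotent: "idempotent_adjunction (dual B) (dual A) G F \<epsilon> \<eta>"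
  using adjunction_dual[OF adjunction_axioms] unit_G_isomorphism
  by (simp add: idempotent_adjunction_def idempotent_adjunction_axioms_def)

lemma GF_Obj: "a \<in> Obj A \<Longrightarrow> OMap G (OMap F a) \<in> Obj A"
  by (simp add: F.OMap_Obj G.OMap_Obj)

lemma mult_hom: "a \<in> Obj A \<Longrightarrow>
    AMap G (\<epsilon> (OMap F a)) \<in> hom A (OMap G (OMap F (OMap G (OMap F a)))) (OMap G (OMap F a))"
  by (intro G.AMap_hom counit_hom F.OMap_Obj)

lemma GF_unit_hom: "a \<in> Obj A \<Longrightarrow>
    AMap G (AMap F (\<eta> a)) \<in> hom A (OMap G (OMap F a)) (OMap G (OMap F (OMap G (OMap F a))))"
  by (intro G.AMap_hom F.AMap_hom unit_hom)

lemma mult_GF_unit: "a \<in> Obj A \<Longrightarrow>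
    Comp A (AMap G (\<epsilon> (OMap F a))) (AMap G (AMap F (\<eta> a))) = Ident A (OMap G (OMap F a))"
  using G.AMap_Comp[OF F.AMap_hom[OF unit_hom] counit_hom[OF F.OMap_Obj]]
  by (simp add: triangle_F G.AMap_Ident F.OMap_Obj)

text \<open>Invertibility of the multiplication turns its section \<open>\<eta>GF\<close> into its inverse.\<close>

lemma unit_mult: "a \<in> Obj A \<Longrightarrow>
    Comp A (\<eta> (OMap G (OMap F a))) (AMap G (\<epsilon> (OMap F a))) =
      Ident A (OMap G (OMap F (OMap G (OMap F a))))"
  using F.source.iso_section[OF mult_hom unit_hom[OF GF_Obj]
      triangle_G[OF F.OMap_Obj] G.AMap_iso[OF counit_F_iso]] by simp

text \<open>Both sides are sections of the multiplication, which has only one since it is invertible.\<close>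

lemma unit_GF_eq: "a \<in> Obj A \<Longrightarrow> \<eta> (OMap G (OMap F a)) = AMap G (AMap F (\<eta> a))"
  using F.source.inverse_unique[OF mult_hom unit_hom[OF GF_Obj] GF_unit_hom] unit_mult mult_GF_unit
  by simp

text \<open>By the triangle identity \<open>F\<eta>\<close> is a section of the invertible \<open>\<epsilon>F\<close>.\<close>

lemma F_unit_iso: "a \<in> Obj A \<Longrightarrow> iso B (AMap F (\<eta> a))"
  using F.target.iso_cancel_left[OF F.AMap_hom[OF unit_hom] counit_hom[OF F.OMap_Obj] counit_F_iso]
  by (simp add: triangle_F F.target.iso_Ident F.OMap_Obj)

lemma unit_retraction_inverse:
  assumes a: "a \<in> Obj A" and h: "h \<in> hom A (OMap G (OMap F a)) a" and e: "Comp A h (\<eta> a) = Ident A a"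
  shows "Comp A (\<eta> a) h = Ident A (OMap G (OMap F a))"
proof -
  have "Comp A (\<eta> a) h = Comp A (AMap G (AMap F h)) (AMap G (AMap F (\<eta> a)))"
    using unit_nat[OF h] unit_GF_eq[OF a] by simp
  also have "\<dots> = AMap G (AMap F (Comp A h (\<eta> a)))"
    using F.AMap_Comp[OF unit_hom[OF a] h] G.AMap_Comp[OF F.AMap_hom F.AMap_hom, OF unit_hom[OF a] h]
    by simp
  finally show ?thesis using a by (simp add: e F.AMap_Ident G.AMap_Ident F.OMap_Obj)
qed

text \<open>A module structure is a retraction of \<open>\<eta>\<^bsub>a\<^esub>\<close>, hence its inverse.  Conversely, for \<open>h = \<eta>\<^bsub>a\<^esub>\<^sup>-\<^sup>1\<close> the
  associativity law follows from \<open>GFh = G\<epsilon>\<^bsub>Fa\<^esub>\<close>, both sides being inverse to \<open>\<eta>\<^bsub>GFa\<^esub> = GF\<eta>\<^bsub>a\<^esub>\<close>.\<close>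

lemma modules_eq:
  "modules A (induced_monad F G \<eta> \<epsilon>) =
    (\<lambda>a. (a, inverse_arrow A (\<eta> a))) ` {a \<in> Obj A. iso A (\<eta> a)}" (is "?M = ?N")
proof (intro set_eqI iffI)
  fix x assume "x \<in> ?M"
  then obtain a h where x: "x = (a, h)" and a: "a \<in> Obj A"
    and h: "h \<in> hom A (OMap G (OMap F a)) a" and e: "Comp A h (\<eta> a) = Ident A a"
    by (auto simp: modules_def induced_monad_def comp_functor_def)
  note e' = unit_retraction_inverse[OF a h e]
  show "x \<in> ?N"
    using isoI[OF unit_hom[OF a] h e e'] F.source.inverse_arrow_eq[OF unit_hom[OF a] h e e'] a x by auto
next
  fix x assume "x \<in> ?N"
  then obtain a where a: "a \<in> Obj A" and i: "iso A (\<eta> a)" and x: "x = (a, inverse_arrow A (\<eta> a))"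
    by auto
  let ?h = "inverse_arrow A (\<eta> a)"
  note h = inverse_arrow[OF i unit_hom[OF a]]
  note Th = G.AMap_hom[OF F.AMap_hom[OF h(1)]]
  have "Comp A (AMap G (AMap F ?h)) (AMap G (AMap F (\<eta> a))) = AMap G (AMap F (Comp A ?h (\<eta> a)))"
    using F.AMap_Comp[OF unit_hom[OF a] h(1)]
      G.AMap_Comp[OF F.AMap_hom F.AMap_hom, OF unit_hom[OF a] h(1)] by simp
  then have "Comp A (AMap G (AMap F ?h)) (\<eta> (OMap G (OMap F a))) = Ident A (OMap G (OMap F a))"
    using a h(2) unit_GF_eq by (simp add: F.AMap_Ident G.AMap_Ident F.OMap_Obj)
  then have "AMap G (AMap F ?h) = AMap G (\<epsilon> (OMap F a))"
    using F.source.inverse_unique[OF unit_hom[OF GF_Obj[OF a]] Th mult_hom[OF a]] unit_mult[OF a]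
    by simp
  then show "x \<in> ?M"
    using a h by (simp add: x modules_def induced_monad_def comp_functor_def)
qed

lemma modules_bij:
  "bij_betw fst (modules A (induced_monad F G \<eta> \<epsilon>)) {a \<in> Obj A. iso A (\<eta> a)}"
  unfolding modules_eq by (auto simp: bij_betw_def inj_on_def image_image)

lemma modules_equivalence:
  "is_equivalence (module_category A (induced_monad F G \<eta> \<epsilon>)) (Fix A \<eta>) forgetful"
proof -
  have o: "bij_betw (OMap forgetful) (Obj (module_category A (induced_monad F G \<eta> \<epsilon>)))
      {a \<in> Obj A. iso A (\<eta> a)}"
    using modules_bij by (simp add: forgetful_def module_category_simps)
  have "full_and_faithful (module_category A (induced_monad F G \<eta> \<epsilon>)) A forgetful"
    using module_full G.AMap_iso counit_F_iso by blast
  then have "full_and_faithful (module_category A (induced_monad F G \<eta> \<epsilon>)) (Fix A \<eta>) forgetful"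
    unfolding Fix_def using o
    by (intro full_and_faithful_full_subcategory) (auto simp: bij_betw_def)
  then show ?thesis
    using o by (intro category_isomorphism_equivalence full_and_faithful_isomorphism)
      (simp_all add: Fix_def)
qed

lemma comodules_equivalence:
  "is_equivalence (comodule_category B (induced_comonad F G \<eta> \<epsilon>)) (Fix B \<epsilon>) forgetful"
proof -
  interpret d: idempotent_adjunction "dual B" "dual A" G F \<epsilon> \<eta> by (rule dual_idempotent)
  have o: "bij_betw (OMap forgetful) (Obj (comodule_category B (induced_comonad F G \<eta> \<epsilon>)))
      {b \<in> Obj B. iso B (\<epsilon> b)}"
    using d.modules_bij by (simp add: forgetful_def comodule_category_simps modules_dual)
  have "full_and_faithful (comodule_category B (induced_comonad F G \<eta> \<epsilon>)) B forgetful"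
    using comodule_full F.AMap_iso unit_G_isomorphism by blast
  then have "full_and_faithful (comodule_category B (induced_comonad F G \<eta> \<epsilon>)) (Fix B \<epsilon>) forgetful"
    unfolding Fix_def using o
    by (intro full_and_faithful_full_subcategory) (auto simp: bij_betw_def)
  then show ?thesis
    using o by (intro category_isomorphism_equivalence full_and_faithful_isomorphism)
      (simp_all add: Fix_def)
qed

text \<open>An isomorphism \<open>f : a \<rightarrow> GFc\<close> transports invertibility of \<open>\<eta>\<close> from \<open>GFc\<close> to \<open>a\<close>, by naturality at
  \<open>f\<close>; conversely \<open>\<eta>\<^bsub>a\<^esub>\<close> itself places a fixed \<open>a\<close> in the image.\<close>

lemma Fix_eq_image_closure: "Fix A \<eta> = image_closure A (G \<odot> F)"
proof -
  have "iso A (\<eta> a)" if a: "a \<in> Obj A" and c: "c \<in> Obj A"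
    and ac: "isomorphic_objects A a (OMap G (OMap F c))" for a c
  proof -
    obtain f where f: "f \<in> hom A a (OMap G (OMap F c))" "iso A f"
      using ac by (auto simp: isomorphic_objects_def)
    have "iso A (Comp A (\<eta> (OMap G (OMap F c))) f)"
      using F.source.iso_Comp[OF f unit_hom[OF GF_Obj]] unit_G_isomorphism c F.OMap_Obj by blast
    then show ?thesis
      using F.source.iso_cancel_left[OF unit_hom[OF a] G.AMap_hom[OF F.AMap_hom[OF f(1)]]]
        F.AMap_iso G.AMap_iso f unit_nat by simp
  qed
  moreover have "\<exists>c \<in> Obj A. isomorphic_objects A a (OMap G (OMap F c))"
    if "a \<in> Obj A" "iso A (\<eta> a)" for a
    using unit_hom that unfolding isomorphic_objects_def by blast
  ultimately have "{a \<in> Obj A. iso A (\<eta> a)} =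
      {a \<in> Obj A. \<exists>c \<in> Obj A. isomorphic_objects A a (OMap (G \<odot> F) c)}"
    unfolding comp_functor_def by auto
  then show ?thesis by (simp add: Fix_def image_closure_def)
qed

text \<open>The counit has to be \<open>\<eta>\<^sup>-\<^sup>1\<close> since one triangle identity says that it is a retraction of \<open>\<eta>\<close>; at
  \<open>GFa\<close> it is the multiplication, so the other one becomes the unit law \<open>mult_GF_unit\<close>.\<close>

lemma Fix_reflective: "reflective_subcategory A (Fix A \<eta>) (G \<odot> F)"
proof -
  let ?X = "{a \<in> Obj A. iso A (\<eta> a)}"
  have GF: "is_functor A A (G \<odot> F)"
    using F.source.Comp_functor F.is_functor_axioms G.is_functor_axioms by blast
  have sub: "subcategory (Fix A \<eta>) A"
    unfolding Fix_def by (rule subcategory_full) (auto simp: F.source.category_axioms)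
  then have inc: "is_functor (Fix A \<eta>) A id_functor" by (simp add: subcategory_def)
  have R: "is_functor A (Fix A \<eta>) (G \<odot> F)"
    using functor_full_subcategory[OF GF subset_refl, of ?X] unit_G_isomorphism
    by (auto simp: Fix_def full_subcategory_Obj F.source.category_axioms comp_functor_def GF_Obj F.OMap_Obj)
  have cat: "category (Fix A \<eta>)" using inc by (simp add: is_functor_def)
  let ?e = "\<lambda>a. inverse_arrow A (\<eta> a)"
  note inv = inverse_arrow[OF _ unit_hom]
  have nat: "Comp A (?e b) (AMap G (AMap F f)) = Comp A f (?e a)"
    if f: "f \<in> hom A a b" and ab: "iso A (\<eta> a)" "iso A (\<eta> b)" for f a b
  proof -
    note o = F.source.hom_Obj[OF f]
    note ia = inv[OF ab(1) o(1)] and ib = inv[OF ab(2) o(2)]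
    note Tf = G.AMap_hom[OF F.AMap_hom[OF f]]
    have "Comp A (?e b) (AMap G (AMap F f)) =
        Comp A (?e b) (Comp A (Comp A (AMap G (AMap F f)) (\<eta> a)) (?e a))"
      using F.source.Comp_assoc[OF ia(1) unit_hom[OF o(1)] Tf] ia F.source.Comp_Ident_right[OF Tf]
      by simp
    also have "\<dots> = Comp A (Comp A (?e b) (\<eta> b)) (Comp A f (?e a))"
      using F.source.Comp_assoc[OF ia(1) f unit_hom[OF o(2)]] unit_nat[OF f]
        F.source.Comp_assoc[OF F.source.Comp_hom[OF ia(1) f] unit_hom[OF o(2)] ib(1)] by simp
    finally show ?thesis
      using ib F.source.Comp_Ident_left[OF F.source.Comp_hom[OF ia(1) f]] by simp
  qed
  interpret Fix: category "Fix A \<eta>" by fact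
  have "adjunction A (Fix A \<eta>) (G \<odot> F) id_functor \<eta> ?e"
  proof (intro adjunction.intro adjunction_axioms.intro natural_transformation.intro
      natural_transformation_axioms.intro R inc functor_id cat F.source.category_axioms
      F.source.Comp_functor[OF R inc] Fix.Comp_functor[OF inc R])
    fix a assume a: "a \<in> Obj A"
    show "\<eta> a \<in> hom A (OMap id_functor a) (OMap (id_functor \<odot> G \<odot> F) a)"
      using unit_hom[OF a] by (simp add: id_functor_def comp_functor_def)
    have "?e (OMap G (OMap F a)) = AMap G (\<epsilon> (OMap F a))"
      using F.source.inverse_arrow_eq[OF unit_hom[OF GF_Obj] mult_hom] a
      by (simp add: triangle_G F.OMap_Obj unit_mult)
    then show "Comp (Fix A \<eta>) (?e (OMap (G \<odot> F) a)) (AMap (G \<odot> F) (\<eta> a)) =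
        Ident (Fix A \<eta>) (OMap (G \<odot> F) a)"
      using a by (simp add: Fix_def comp_functor_def mult_GF_unit)
  next
    fix f a b assume "f \<in> hom A a b"
    then show "Comp A (\<eta> b) (AMap id_functor f) = Comp A (AMap (id_functor \<odot> G \<odot> F) f) (\<eta> a)"
      using unit_nat by (simp add: id_functor_def comp_functor_def)
  next
    fix a assume a: "a \<in> Obj (Fix A \<eta>)"
    then show "?e a \<in> hom (Fix A \<eta>) (OMap ((G \<odot> F) \<odot> id_functor) a) (OMap id_functor a)"
      using inv(1) by (simp add: Fix_def id_functor_def comp_functor_def unit_G_isomorphism GF_Obj F.OMap_Obj)
    show "Comp A (AMap id_functor (?e a)) (\<eta> (OMap id_functor a)) = Ident A (OMap id_functor a)"
      using inv(2) a by (simp add: Fix_def id_functor_def)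
  next
    fix f a b assume "f \<in> hom (Fix A \<eta>) a b"
    then show "Comp (Fix A \<eta>) (?e b) (AMap ((G \<odot> F) \<odot> id_functor) f) =
        Comp (Fix A \<eta>) (AMap id_functor f) (?e a)"
      using nat by (simp add: Fix_def id_functor_def comp_functor_def)
  qed
  then show ?thesis using sub by (auto simp: reflective_subcategory_def)
qed

lemma Fix_equivalence: "inverse_equivalences (Fix A \<eta>) (Fix B \<epsilon>) F G"
proof -
  let ?X = "{a \<in> Obj A. iso A (\<eta> a)}" and ?Y = "{b \<in> Obj B. iso B (\<epsilon> b)}"
  let ?A = "full_subcategory A ?X" and ?B = "full_subcategory B ?Y"
  have F: "is_functor ?A ?B F"
    by (rule functor_full_subcategory[OF F.is_functor_axioms])
      (simp_all add: counit_F_iso F.OMap_Obj Collect_subset)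
  have G: "is_functor ?B ?A G"
    by (rule functor_full_subcategory[OF G.is_functor_axioms])
      (simp_all add: unit_G_isomorphism G.OMap_Obj Collect_subset)
  interpret F': is_functor ?A ?B F by (rule F)
  have "natural_isomorphism ?A ?A id_functor (G \<odot> F) \<eta>"
    by (rule natural_isomorphism_full_subcategory[OF unit.natural_transformation_axioms
        functor_id[OF F'.source.category_axioms] F'.source.Comp_functor[OF F G]]) auto
  moreover have "natural_isomorphism ?B ?B (F \<odot> G) id_functor \<epsilon>"
    by (rule natural_isomorphism_full_subcategory[OF counit.natural_transformation_axioms
        F'.target.Comp_functor[OF G F] functor_id[OF F'.target.category_axioms]]) auto
  ultimately show ?thesis
    unfolding inverse_equivalences_def Fix_def by (intro conjI F G exI)
qed

text \<open>Naturality of the invertible \<open>\<epsilon>F\<close> makes \<open>Ff\<close> conjugate to \<open>FGFf\<close>.\<close>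

lemma inverted_arrows_eq: "inverted_arrows A A (G \<odot> F) = inverted_arrows A B F"
proof -
  have "iso B (AMap F f)" if f: "f \<in> hom A a b" and i: "iso A (AMap G (AMap F f))" for f a b
  proof -
    note o = F.source.hom_Obj[OF f]
    note Ff = F.AMap_hom[OF f]
    have "iso B (Comp B (\<epsilon> (OMap F b)) (AMap F (AMap G (AMap F f))))"
      using F.target.iso_Comp[OF F.AMap_hom[OF G.AMap_hom[OF Ff]] F.AMap_iso[OF i]
          counit_hom[OF F.OMap_Obj[OF o(2)]] counit_F_iso[OF o(2)]] .
    then show ?thesis
      using F.target.iso_cancel_right[OF counit_hom[OF F.OMap_Obj[OF o(1)]] counit_F_iso[OF o(1)] Ff]
        counit_nat[OF Ff] by simp
  qed
  then show ?thesis
    using G.AMap_iso homI[of _ A] unfolding inverted_arrows_def comp_functor_def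
    by (simp add: set_eq_iff) blast
qed

end

section \<open>Categories of fractions\<close>

lemma path_append_path: "path C S a u b \<Longrightarrow> path C S b v c \<Longrightarrow> path C S a (u @ v) c"
  by (induction u arbitrary: a) auto

context category
begin

lemma edge_Obj: "edge_from_to C S a e b \<Longrightarrow> a \<in> Obj C \<and> b \<in> Obj C"
  by (cases e) (auto dest: hom_Obj)

lemma path_Obj: "path C S a w b \<Longrightarrow> a \<in> Obj C \<and> b \<in> Obj C"
  by (induction w arbitrary: a) (auto dest: edge_Obj)

lemma path_eq_paths: "path_eq C S a b u v \<Longrightarrow> path C S a u b \<and> path C S a v b"
  by (induction rule: path_eq.induct)
    (auto intro: path_append_path Ident_hom Comp_hom hom_Obj)

lemma path_class_eq: "path C S a u b \<Longrightarrow> path_class C S a b u = path_class C S a b v \<longleftrightarrow> path_eq C S a b u v"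
  unfolding path_class_def set_eq_iff mem_Collect_eq by (meson path_refl path_sym path_trans)

lemma path_class_self: "path C S a u b \<Longrightarrow> u \<in> path_class C S a b u"
  by (simp add: path_class_def path_refl)

lemma hom_fractions: "p \<in> hom (fractions C S) a b \<longleftrightarrow>
    (\<exists>w. path C S a w b \<and> p = (a, b, path_class C S a b w))"
  unfolding hom_def[of "fractions C S"] by (cases p) (auto simp: fractions_def)

lemma fractions_simps:
  "Obj (fractions C S) = Obj C"
  "Ident (fractions C S) a = (a, a, path_class C S a a [])"
  "Dom (fractions C S) (a, b, X) = a"
  "Cod (fractions C S) (a, b, X) = b"
  by (simp_all add: fractions_def)

lemma Comp_fractions:
  assumes u: "path C S a u b" and v: "path C S b v c"
  shows "Comp (fractions C S) (b, c, path_class C S b c v) (a, b, path_class C S a b u) =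
    (a, c, path_class C S a c (u @ v))"
proof -
  have "path_class C S a c (u' @ v') = path_class C S a c (u @ v)"
    if "u' \<in> path_class C S a b u" "v' \<in> path_class C S b c v" for u' v'
  proof -
    have "path_eq C S a c (u @ v) (u' @ v')"
      using that path_append by (simp add: path_class_def)
    then show ?thesis using path_class_eq[OF path_append_path[OF u v]] by blast
  qed
  then have "(\<Union>u' \<in> path_class C S a b u. \<Union>v' \<in> path_class C S b c v. path_class C S a c (u' @ v'))
      = path_class C S a c (u @ v)"
    using path_class_self[OF u] path_class_self[OF v] by blast
  then show ?thesis by (simp add: fractions_def)
qed

lemma category_fractions: "category (fractions C S)"
proof
  fix f assume "f \<in> Arr (fractions C S)"
  then obtain a b w where "f = (a, b, path_class C S a b w)" "path C S a w b"
    by (auto simp: fractions_def)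
  then show "Dom (fractions C S) f \<in> Obj (fractions C S)" "Cod (fractions C S) f \<in> Obj (fractions C S)"
    using path_Obj by (auto simp: fractions_simps)
next
  fix a assume "a \<in> Obj (fractions C S)"
  then show "Ident (fractions C S) a \<in> hom (fractions C S) a a"
    by (auto simp: hom_fractions fractions_simps intro!: exI[of _ "[]"])
next
  fix f g a b c assume "f \<in> hom (fractions C S) a b" "g \<in> hom (fractions C S) b c"
  then obtain u v where f: "f = (a, b, path_class C S a b u)" "path C S a u b"
    and g: "g = (b, c, path_class C S b c v)" "path C S b v c"
    unfolding hom_fractions by auto
  then show "Comp (fractions C S) g f \<in> hom (fractions C S) a c"
    using path_append_path[OF f(2) g(2)] by (auto simp: hom_fractions Comp_fractions)
next
  fix f a b assume "f \<in> hom (fractions C S) a b"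
  then obtain w where f: "f = (a, b, path_class C S a b w)" "path C S a w b"
    by (auto simp: hom_fractions)
  have "path C S a [] a" "path C S b [] b" using path_Obj[OF f(2)] by simp_all
  then show "Comp (fractions C S) f (Ident (fractions C S) a) = f"
    "Comp (fractions C S) (Ident (fractions C S) b) f = f"
    using Comp_fractions[of S a "[]" a w b] Comp_fractions[of S a w b "[]" b] f
    by (simp_all add: fractions_simps)
next
  fix f g h a b c d
  assume "f \<in> hom (fractions C S) a b" "g \<in> hom (fractions C S) b c" "h \<in> hom (fractions C S) c d"
  then obtain u v w where f: "f = (a, b, path_class C S a b u)" "path C S a u b"
    and g: "g = (b, c, path_class C S b c v)" "path C S b v c"
    and h: "h = (c, d, path_class C S c d w)" "path C S c w d"
    unfolding hom_fractions by auto
  show "Comp (fractions C S) h (Comp (fractions C S) g f) =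
      Comp (fractions C S) (Comp (fractions C S) h g) f"
    using Comp_fractions[OF f(2) g(2)] Comp_fractions[OF path_append_path[OF f(2) g(2)] h(2)]
      Comp_fractions[OF g(2) h(2)] Comp_fractions[OF f(2) path_append_path[OF g(2) h(2)]]
    by (simp add: f(1) g(1) h(1))
qed

text \<open>Splitting \<open>g \<cdot> s\<close> lets the two passages of \<open>s\<close> cancel; read from left to right, this removes a backward
  edge whenever the arrow after it extends along \<open>s\<close>.\<close>

lemma path_eq_extend:
  assumes s: "s \<in> S" "s \<in> hom C a b" and g: "g \<in> hom C b c"
    and w: "path C S c w d"
  shows "path_eq C S b d (Bwd s # Fwd (Comp C g s) # w) (Fwd g # w)"
proof -
  note w = path_refl[OF w]
  have 1: "path_eq C S b a [Bwd s] [Bwd s]" by (rule path_refl) (use s hom_Obj in auto)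
  have 2: "path_eq C S b c [Fwd g] [Fwd g]" by (rule path_refl) (use g hom_Obj in auto)
  have "path_eq C S b c [Bwd s, Fwd (Comp C g s)] [Bwd s, Fwd s, Fwd g]"
    using path_append[OF 1 path_sym[OF path_Comp[OF s(2) g]]] by simp
  moreover have "path_eq C S b c [Bwd s, Fwd s, Fwd g] [Fwd g]"
    using path_append[OF path_Bwd_Fwd[OF s] 2] by simp
  ultimately have "path_eq C S b c [Bwd s, Fwd (Comp C g s)] [Fwd g]" by (rule path_trans)
  from path_append[OF this w] show ?thesis by simp
qed

lemma path_eq_Fwd_Fwd:
  assumes "f \<in> hom C a b" "g \<in> hom C b c" "path C S c w d"
  shows "path_eq C S a d (Fwd f # Fwd g # w) (Fwd (Comp C g f) # w)"
  using path_append[OF path_Comp[OF assms(1,2)] path_refl[OF assms(3)]] by simp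

end

context is_functor
begin

text \<open>The value of a path under a functor that inverts \<open>S\<close>; the end \<open>b\<close> of the path is an argument because
  the empty path does not record its object.\<close>

primrec path_value :: "'o \<Rightarrow> 'm edge list \<Rightarrow> 'n" where
  "path_value b [] = Ident D (OMap F b)"
| "path_value b (e # w) = Comp D (path_value b w)
     (case e of Fwd f \<Rightarrow> AMap F f | Bwd s \<Rightarrow> inverse_arrow D (AMap F s))"

context
  fixes S
  assumes inverts: "\<And>s. s \<in> S \<Longrightarrow> iso D (AMap F s)"
begin

lemma edge_value_hom:
  assumes "edge_from_to C S a e b"
  shows "(case e of Fwd f \<Rightarrow> AMap F f | Bwd s \<Rightarrow> inverse_arrow D (AMap F s))
    \<in> hom D (OMap F a) (OMap F b)"
  using assms by (cases e) (auto simp: AMap_hom intro: inverse_arrow(1)[OF inverts AMap_hom])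

lemma path_value_hom: "path C S a w b \<Longrightarrow> path_value b w \<in> hom D (OMap F a) (OMap F b)"
  by (induction w arbitrary: a)
    (auto simp: OMap_Obj target.Ident_hom intro: target.Comp_hom[OF edge_value_hom])

lemma path_value_append:
  "path C S a u b \<Longrightarrow> path C S b v c \<Longrightarrow>
    path_value c (u @ v) = Comp D (path_value c v) (path_value b u)"
proof (induction u arbitrary: a)
  case Nil
  then show ?case using target.Comp_Ident_right[OF path_value_hom] by simp
next
  case (Cons e u)
  then obtain d where d: "edge_from_to C S a e d" "path C S d u b" by auto
  then show ?case
    using Cons target.Comp_assoc[OF edge_value_hom[OF d(1)] path_value_hom[OF d(2)]
        path_value_hom[OF Cons.prems(2)]] by simp
qed

text \<open>Congruent paths have equal values because a functor that inverts \<open>S\<close> respects each generating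
  relation; so the value can show that two paths are not congruent.\<close>

lemma path_value_cong: "path_eq C S a b u v \<Longrightarrow> path_value b u = path_value b v"
proof (induction rule: path_eq.induct)
  case (path_append a b u u' c v v')
  then show ?case
    using source.path_eq_paths[OF path_append(1)] source.path_eq_paths[OF path_append(2)]
      path_value_append[of a u b v c] path_value_append[of a u' b v' c] by simp
next
  case (path_Ident a)
  then show ?case
    by (simp add: AMap_Ident target.Comp_Ident_right[OF target.Ident_hom] OMap_Obj)
next
  case (path_Comp f a b g c)
  then show ?case
    by (simp add: AMap_Comp target.Comp_Ident_left[OF AMap_hom]
        target.Comp_Ident_left[OF target.Comp_hom[OF AMap_hom AMap_hom]])
next
  case (path_Fwd_Bwd s a b)
  note i = inverse_arrow[OF inverts[OF path_Fwd_Bwd(1)] AMap_hom[OF path_Fwd_Bwd(2)]]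
  show ?case using i by (simp add: target.Comp_Ident_left[OF i(1)])
next
  case (path_Bwd_Fwd s a b)
  note i = inverse_arrow[OF inverts[OF path_Bwd_Fwd(1)] AMap_hom[OF path_Bwd_Fwd(2)]]
  show ?case using i by (simp add: target.Comp_Ident_left[OF AMap_hom[OF path_Bwd_Fwd(2)]])
qed simp_all

end

end

section \<open>The Kleisli category\<close>

lemma hom_kleisli: "p \<in> hom (kleisli_category C T) a b \<longleftrightarrow>
    a \<in> Obj C \<and> b \<in> Obj C \<and> (\<exists>f. p = (a, b, f) \<and> f \<in> hom C a (OMap (Endo T) b))"
  unfolding hom_def[of "kleisli_category C T"] by (cases p) (auto simp: kleisli_category_def)

lemma kleisli_simps:
  "Obj (kleisli_category C T) = Obj C"
  "Ident (kleisli_category C T) a = (a, a, Unit T a)"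
  "Dom (kleisli_category C T) (a, b, f) = a"
  "Cod (kleisli_category C T) (a, b, f) = b"
  "Comp (kleisli_category C T) (b, c, g) (a, b', f) =
    (a, c, Comp C (Mult T c) (Comp C (AMap (Endo T) g) f))"
  by (simp_all add: kleisli_category_def)

context adjunction
begin

text \<open>The two directions of the adjunction bijection between \<open>Fa \<rightarrow> b\<close> and \<open>a \<rightarrow> Gb\<close>.\<close>

definition sharp :: "'o \<Rightarrow> 'n \<Rightarrow> 'm" where
  "sharp a h = Comp A (AMap G h) (\<eta> a)"

definition flat :: "'p \<Rightarrow> 'm \<Rightarrow> 'n" where
  "flat b f = Comp B (\<epsilon> b) (AMap F f)"

lemma sharp_hom: "a \<in> Obj A \<Longrightarrow> h \<in> hom B (OMap F a) b \<Longrightarrow> sharp a h \<in> hom A a (OMap G b)"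
  unfolding sharp_def by (rule F.source.Comp_hom[OF unit_hom G.AMap_hom])

lemma flat_hom: "b \<in> Obj B \<Longrightarrow> f \<in> hom A a (OMap G b) \<Longrightarrow> flat b f \<in> hom B (OMap F a) b"
  unfolding flat_def by (rule F.target.Comp_hom[OF F.AMap_hom counit_hom])

lemma sharp_natural:
  assumes s: "s \<in> hom A c a" and h: "h \<in> hom B (OMap F a) b"
  shows "Comp A (sharp a h) s = sharp c (Comp B h (AMap F s))"
proof -
  note o = F.source.hom_Obj[OF s]
  show ?thesis
    using F.source.Comp_assoc[OF s unit_hom[OF o(2)] G.AMap_hom[OF h]] unit_nat[OF s]
      F.source.Comp_assoc[OF unit_hom[OF o(1)] G.AMap_hom[OF F.AMap_hom[OF s]] G.AMap_hom[OF h]]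
      G.AMap_Comp[OF F.AMap_hom[OF s] h]
    by (simp add: sharp_def)
qed

lemma sharp_flat:
  assumes b: "b \<in> Obj B" and f: "f \<in> hom A a (OMap G b)"
  shows "sharp a (flat b f) = f"
proof -
  have Gb: "OMap G b \<in> Obj A" using b by (rule G.OMap_Obj)
  have "sharp a (flat b f) = Comp A (sharp (OMap G b) (\<epsilon> b)) f"
    using sharp_natural[OF f counit_hom[OF b]] by (simp add: flat_def)
  then show ?thesis
    using b F.source.Comp_Ident_left[OF f] by (simp add: sharp_def triangle_G)
qed

lemma flat_unit: "a \<in> Obj A \<Longrightarrow> flat (OMap F a) (\<eta> a) = Ident B (OMap F a)"
  by (simp add: flat_def triangle_F)

lemma flat_natural:
  assumes f: "f \<in> hom A a (OMap G b)" and h: "h \<in> hom B b c"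
  shows "flat c (Comp A (AMap G h) f) = Comp B h (flat b f)"
proof -
  note o = F.target.hom_Obj[OF h]
  show ?thesis
    using F.AMap_Comp[OF f G.AMap_hom[OF h]] counit_nat[OF h]
      F.target.Comp_assoc[OF F.AMap_hom[OF f] F.AMap_hom[OF G.AMap_hom[OF h]] counit_hom[OF o(2)]]
      F.target.Comp_assoc[OF F.AMap_hom[OF f] counit_hom[OF o(1)] h]
    by (simp add: flat_def)
qed

abbreviation kleisli :: "('o, 'o \<times> 'o \<times> 'm) cat" where
  "kleisli \<equiv> kleisli_category A (induced_monad F G \<eta> \<epsilon>)"

lemma hom_kleisli_induced: "p \<in> hom kleisli a b \<longleftrightarrow>
    a \<in> Obj A \<and> b \<in> Obj A \<and> (\<exists>f. p = (a, b, f) \<and> f \<in> hom A a (OMap G (OMap F b)))"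
  by (simp add: hom_kleisli induced_monad_def comp_functor_def)

lemma Comp_kleisli:
  assumes f: "f \<in> hom A a (OMap G (OMap F b))" and g: "g \<in> hom A b (OMap G (OMap F c))"
    and c: "c \<in> Obj A"
  shows "Comp kleisli (b, c, g) (a, b, f) = (a, c, Comp A (AMap G (flat (OMap F c) g)) f)"
proof -
  have e: "\<epsilon> (OMap F c) \<in> hom B (OMap F (OMap G (OMap F c))) (OMap F c)"
    using c by (intro counit_hom F.OMap_Obj)
  show ?thesis
    using F.source.Comp_assoc[OF f G.AMap_hom[OF F.AMap_hom[OF g]] G.AMap_hom[OF e]]
      G.AMap_Comp[OF F.AMap_hom[OF g] e]
    by (simp add: kleisli_simps induced_monad_def comp_functor_def flat_def)
qed

text \<open>Transposition turns Kleisli composition into composition in \<open>B\<close>, so the category laws for Kleisli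
  arrows are inherited from \<open>B\<close>.\<close>

lemma Comp_kleisli_sharp:
  assumes f: "f \<in> hom A a (OMap G (OMap F b))" and g: "g \<in> hom A b (OMap G (OMap F c))"
    and o: "b \<in> Obj A" "c \<in> Obj A"
  shows "Comp kleisli (b, c, g) (a, b, f) =
    (a, c, sharp a (Comp B (flat (OMap F c) g) (flat (OMap F b) f)))"
proof -
  note F = F.OMap_Obj[OF o(1)] F.OMap_Obj[OF o(2)]
  note g' = flat_hom[OF F(2) g]
  have "flat (OMap F c) (Comp A (AMap G (flat (OMap F c) g)) f) =
      Comp B (flat (OMap F c) g) (flat (OMap F b) f)"
    using flat_natural[OF f g'] .
  then show ?thesis
    using sharp_flat[OF F(2) F.source.Comp_hom[OF f G.AMap_hom[OF g']]] Comp_kleisli[OF f g o(2)]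
    by simp
qed

lemma flat_sharp:
  assumes "a \<in> Obj A" "h \<in> hom B (OMap F a) b"
  shows "flat b (sharp a h) = h"
  using flat_natural[OF unit_hom[OF assms(1)] assms(2)] flat_unit[OF assms(1)]
    F.target.Comp_Ident_right[OF assms(2)] by (simp add: sharp_def)

lemma category_kleisli: "category kleisli"
proof
  fix f assume "f \<in> Arr kleisli"
  then show "Dom kleisli f \<in> Obj kleisli" "Cod kleisli f \<in> Obj kleisli"
    by (auto simp: kleisli_category_def)
next
  fix a assume "a \<in> Obj kleisli"
  then show "Ident kleisli a \<in> hom kleisli a a"
    using unit_hom by (simp add: hom_kleisli_induced kleisli_simps) (simp add: induced_monad_def)
next
  fix f g a b c assume "f \<in> hom kleisli a b" "g \<in> hom kleisli b c"
  then show "Comp kleisli g f \<in> hom kleisli a c"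
    unfolding hom_kleisli_induced
    by (elim conjE exE)
      (simp add: Comp_kleisli_sharp sharp_hom F.target.Comp_hom[OF flat_hom flat_hom] F.OMap_Obj)
next
  fix p a b assume "p \<in> hom kleisli a b"
  then obtain f where o: "a \<in> Obj A" "b \<in> Obj A" and p: "p = (a, b, f)"
    and f: "f \<in> hom A a (OMap G (OMap F b))"
    by (auto simp: hom_kleisli_induced)
  note Fo = F.OMap_Obj[OF o(1)] F.OMap_Obj[OF o(2)]
  note f' = flat_hom[OF Fo(2) f]
  have I: "Ident kleisli c = (c, c, \<eta> c)" for c
    by (simp add: kleisli_simps induced_monad_def)
  show "Comp kleisli p (Ident kleisli a) = p" "Comp kleisli (Ident kleisli b) p = p"
    using Comp_kleisli_sharp[OF unit_hom[OF o(1)] f o] Comp_kleisli_sharp[OF f unit_hom[OF o(2)] o(2) o(2)]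
      F.target.Comp_Ident_left[OF f'] F.target.Comp_Ident_right[OF f']
      sharp_flat[OF Fo(2) f] o by (simp_all add: I p flat_unit)
next
  fix p q r a b c d assume "p \<in> hom kleisli a b" "q \<in> hom kleisli b c" "r \<in> hom kleisli c d"
  then obtain f g h where o: "a \<in> Obj A" "b \<in> Obj A" "c \<in> Obj A" "d \<in> Obj A"
    and p: "p = (a, b, f)" "f \<in> hom A a (OMap G (OMap F b))"
    and q: "q = (b, c, g)" "g \<in> hom A b (OMap G (OMap F c))"
    and r: "r = (c, d, h)" "h \<in> hom A c (OMap G (OMap F d))"
    unfolding hom_kleisli_induced by blast
  note f' = flat_hom[OF F.OMap_Obj[OF o(2)] p(2)]
    and g' = flat_hom[OF F.OMap_Obj[OF o(3)] q(2)]
    and h' = flat_hom[OF F.OMap_Obj[OF o(4)] r(2)]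
  note gf = F.target.Comp_hom[OF f' g'] and hg = F.target.Comp_hom[OF g' h']
  show "Comp kleisli r (Comp kleisli q p) = Comp kleisli (Comp kleisli r q) p"
    using Comp_kleisli_sharp[OF p(2) q(2)] Comp_kleisli_sharp[OF q(2) r(2)]
      Comp_kleisli_sharp[OF sharp_hom[OF o(1) gf] r(2)] Comp_kleisli_sharp[OF p(2) sharp_hom[OF o(2) hg]]
      flat_sharp[OF o(1) gf] flat_sharp[OF o(2) hg] F.target.Comp_assoc[OF f' g' h'] o
    by (simp add: p(1) q(1) r(1))
qed

text \<open>Objects \<open>Gb\<close> are local: transposing \<open>g\<close> to \<open>B\<close>, where \<open>Fs\<close> can be inverted, and transposing back gives
  the extension.\<close>

lemma extend_along_inverted:
  assumes s: "s \<in> hom A c a" "iso B (AMap F s)" and g: "g \<in> hom A c (OMap G b)" and b: "b \<in> Obj B"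
  obtains g' where "g' \<in> hom A a (OMap G b)" "Comp A g' s = g"
proof -
  note i = inverse_arrow[OF s(2) F.AMap_hom[OF s(1)]]
  note g' = flat_hom[OF b g]
  let ?h = "Comp B (flat b g) (inverse_arrow B (AMap F s))"
  have h: "?h \<in> hom B (OMap F a) b" using F.target.Comp_hom[OF i(1) g'] .
  have "Comp B ?h (AMap F s) = flat b g"
    using F.target.Comp_assoc[OF F.AMap_hom[OF s(1)] i(1) g'] i(2) F.target.Comp_Ident_right[OF g']
    by simp
  then have "Comp A (sharp a ?h) s = g"
    using sharp_natural[OF s(1) h] sharp_flat[OF b g] by simp
  then show ?thesis
    using that sharp_hom[OF _ h] F.source.hom_Obj[OF s(1)] by blast
qed

end

section \<open>Kleisli arrows as fractions\<close>

context idempotent_adjunction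
begin

abbreviation \<Sigma> :: "'m set" where
  "\<Sigma> \<equiv> inverted_arrows A B F"

lemma inverted_iso: "s \<in> \<Sigma> \<Longrightarrow> iso B (AMap F s)"
  by (simp add: inverted_arrows_def)

lemma unit_inverted: "a \<in> Obj A \<Longrightarrow> \<eta> a \<in> \<Sigma>"
  using unit_hom F_unit_iso by (auto simp: inverted_arrows_def hom_def)

definition roof :: "'o \<Rightarrow> 'm \<Rightarrow> 'm edge list" where
  "roof b f = [Fwd f, Bwd (\<eta> b)]"

lemma path_Bwd_unit: "b \<in> Obj A \<Longrightarrow> path A \<Sigma> (OMap G (OMap F b)) [Bwd (\<eta> b)] b"
  using unit_hom unit_inverted by auto

lemma path_roof: "b \<in> Obj A \<Longrightarrow> f \<in> hom A a (OMap G (OMap F b)) \<Longrightarrow> path A \<Sigma> a (roof b f) b"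
  using path_Bwd_unit by (auto simp: roof_def)

text \<open>The path is normalized from its end.  The empty path is congruent to the roof of \<open>\<eta>\<close>; a forward edge is composed
  with the forward edge of the roof; for a backward edge, that forward edge is extended along the
  reversed arrow, which then cancels.\<close>

lemma path_eq_roof:
  "path A \<Sigma> a w b \<Longrightarrow> \<exists>f \<in> hom A a (OMap G (OMap F b)). path_eq A \<Sigma> a b w (roof b f)"
proof (induction w arbitrary: a)
  case Nil
  then have b: "b \<in> Obj A" "a = b" by auto
  show ?case
    using unit_hom[OF b(1)] path_sym[OF path_Fwd_Bwd[OF unit_inverted unit_hom]] b
    by (auto simp: roof_def)
next
  case (Cons e w)
  then obtain c where e: "edge_from_to A \<Sigma> a e c" and w: "path A \<Sigma> c w b" by auto
  obtain g where g: "g \<in> hom A c (OMap G (OMap F b))" and wg: "path_eq A \<Sigma> c b w (roof b g)"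
    using Cons.IH[OF w] by blast
  have b: "b \<in> Obj A" and c: "c \<in> Obj A" using F.source.path_Obj[OF w] by auto
  have "path A \<Sigma> a [e] c" using e c by auto
  then have 1: "path_eq A \<Sigma> a b (e # w) (e # roof b g)"
    using path_append[OF path_refl wg] by fastforce
  show ?case
  proof (cases e)
    case (Fwd f)
    then have f: "f \<in> hom A a c" using e by simp
    show ?thesis
      using path_trans[OF 1] F.source.path_eq_Fwd_Fwd[OF f g path_Bwd_unit[OF b]]
        F.source.Comp_hom[OF f g] by (auto simp: Fwd roof_def)
  next
    case (Bwd s)
    then have s: "s \<in> \<Sigma>" "s \<in> hom A c a" using e by auto
    obtain g' where g': "g' \<in> hom A a (OMap G (OMap F b))" "Comp A g' s = g"
      using extend_along_inverted[OF s(2) inverted_iso[OF s(1)] g F.OMap_Obj[OF b]] .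
    show ?thesis
      using path_trans[OF 1] F.source.path_eq_extend[OF s g'(1) path_Bwd_unit[OF b]] g'
      by (auto simp: Bwd roof_def)
  qed
qed

text \<open>The value of the backward edge is \<open>(F\<eta>\<^bsub>b\<^esub>)\<^sup>-\<^sup>1 = \<epsilon>\<^bsub>Fb\<^esub>\<close>, by a triangle identity.\<close>

lemma path_value_roof:
  assumes b: "b \<in> Obj A" and f: "f \<in> hom A a (OMap G (OMap F b))"
  shows "F.path_value b (roof b f) = flat (OMap F b) f"
proof -
  note Fb = F.OMap_Obj[OF b]
  have h: "AMap F (\<eta> b) \<in> hom B (OMap F b) (OMap F (OMap G (OMap F b)))"
    using F.AMap_hom[OF unit_hom[OF b]] .
  obtain k where k: "k \<in> hom B (OMap F (OMap G (OMap F b))) (OMap F b)"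
    "Comp B k (AMap F (\<eta> b)) = Ident B (OMap F b)"
    "Comp B (AMap F (\<eta> b)) k = Ident B (OMap F (OMap G (OMap F b)))"
    using isoE[OF F_unit_iso[OF b] h] .
  have "k = \<epsilon> (OMap F b)"
    using F.target.inverse_unique[OF h counit_hom[OF Fb] k(1) triangle_F[OF b] k(3)] by simp
  then have "inverse_arrow B (AMap F (\<eta> b)) = \<epsilon> (OMap F b)"
    using F.target.inverse_arrow_eq[OF h k] by simp
  then show ?thesis
    by (simp add: roof_def flat_def F.target.Comp_Ident_left[OF counit_hom[OF Fb]])
qed

definition fraction :: "('o, 'o \<times> 'o \<times> 'm, 'o, 'o \<times> 'o \<times> 'm edge list set) func" where
  "fraction = \<lparr>OMap = (\<lambda>a. a), AMap = (\<lambda>(a, b, f). (a, b, path_class A \<Sigma> a b (roof b f)))\<rparr>"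

text \<open>Since \<open>g\<close> is the restriction along \<open>\<eta>\<^bsub>b\<^esub>\<close> of \<open>G(\<epsilon>\<^bsub>Fc\<^esub> \<cdot> Fg)\<close>, the inner backward edge can be absorbed;
  what remains is the Kleisli composite.\<close>

lemma path_eq_roof_roof:
  assumes f: "f \<in> hom A a (OMap G (OMap F b))" and g: "g \<in> hom A b (OMap G (OMap F c))"
    and b: "b \<in> Obj A" and c: "c \<in> Obj A"
  shows "path_eq A \<Sigma> a c (roof b f @ roof c g) (roof c (Comp A (AMap G (flat (OMap F c) g)) f))"
proof -
  let ?g = "AMap G (flat (OMap F c) g)"
  have g': "?g \<in> hom A (OMap G (OMap F b)) (OMap G (OMap F c))"
    using G.AMap_hom[OF flat_hom[OF F.OMap_Obj[OF c] g]] .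
  have "Comp A ?g (\<eta> b) = g"
    using sharp_flat[OF F.OMap_Obj[OF c] g] by (simp add: sharp_def)
  then have "path_eq A \<Sigma> (OMap G (OMap F b)) c (Bwd (\<eta> b) # roof c g) (Fwd ?g # [Bwd (\<eta> c)])"
    using F.source.path_eq_extend[OF unit_inverted[OF b] unit_hom[OF b] g' path_Bwd_unit[OF c]]
    by (simp add: roof_def)
  moreover have "path A \<Sigma> a [Fwd f] (OMap G (OMap F b))"
    using f F.source.hom_Obj[OF f] by simp
  ultimately have "path_eq A \<Sigma> a c (roof b f @ roof c g) (Fwd f # Fwd ?g # [Bwd (\<eta> c)])"
    using path_append[OF path_refl] by (fastforce simp: roof_def)
  then show ?thesis
    using path_trans F.source.path_eq_Fwd_Fwd[OF f g' path_Bwd_unit[OF c]] by (fastforce simp: roof_def)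
qed

lemma fraction_functor: "is_functor kleisli (fractions A \<Sigma>) fraction"
proof (intro is_functor.intro is_functor_axioms.intro category_kleisli F.source.category_fractions)
  fix a assume "a \<in> Obj kleisli"
  then have a: "a \<in> Obj A" by (simp add: kleisli_simps)
  then show "OMap fraction a \<in> Obj (fractions A \<Sigma>)"
    by (simp add: fraction_def F.source.fractions_simps)
  have "path_class A \<Sigma> a a (roof a (\<eta> a)) = path_class A \<Sigma> a a []"
    using F.source.path_class_eq[OF path_roof[OF a unit_hom[OF a]]]
      path_Fwd_Bwd[OF unit_inverted[OF a] unit_hom[OF a]] by (simp add: roof_def)
  then show "AMap fraction (Ident kleisli a) = Ident (fractions A \<Sigma>) (OMap fraction a)"
    by (simp add: fraction_def F.source.fractions_simps kleisli_simps induced_monad_def)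
next
  fix f a b assume "f \<in> hom kleisli a b"
  then show "AMap fraction f \<in> hom (fractions A \<Sigma>) (OMap fraction a) (OMap fraction b)"
    using path_roof by (auto simp: hom_kleisli_induced F.source.hom_fractions fraction_def)
next
  fix p q a b c assume "p \<in> hom kleisli a b" "q \<in> hom kleisli b c"
  then obtain f g where o: "a \<in> Obj A" "b \<in> Obj A" "c \<in> Obj A"
    and p: "p = (a, b, f)" "f \<in> hom A a (OMap G (OMap F b))"
    and q: "q = (b, c, g)" "g \<in> hom A b (OMap G (OMap F c))"
    unfolding hom_kleisli_induced by blast
  note paths = path_roof[OF o(2) p(2)] path_roof[OF o(3) q(2)]
  have "path_class A \<Sigma> a c (roof b f @ roof c g) =
      path_class A \<Sigma> a c (roof c (Comp A (AMap G (flat (OMap F c) g)) f))"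
    by (rule F.source.path_class_eq[OF path_append_path[OF paths], THEN iffD2,
          OF path_eq_roof_roof[OF p(2) q(2) o(2,3)]])
  then show "AMap fraction (Comp kleisli q p) =
      Comp (fractions A \<Sigma>) (AMap fraction q) (AMap fraction p)"
    using Comp_kleisli[OF p(2) q(2) o(3)] F.source.Comp_fractions[OF paths]
    by (simp add: p(1) q(1) fraction_def)
qed

text \<open>Faithful because evaluation along \<open>F\<close> recovers the transpose of the Kleisli arrow, full because every
  path is congruent to a roof.\<close>

lemma fraction_full_and_faithful: "full_and_faithful kleisli (fractions A \<Sigma>) fraction"
  unfolding full_and_faithful_def
proof (intro conjI ballI fraction_functor)
  fix a b assume "a \<in> Obj kleisli" "b \<in> Obj kleisli"
  then have o: "a \<in> Obj A" "b \<in> Obj A" by (simp_all add: kleisli_simps)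
  have "inj_on (AMap fraction) (hom kleisli a b)"
  proof (rule inj_onI)
    fix p q assume pq: "p \<in> hom kleisli a b" "q \<in> hom kleisli a b" "AMap fraction p = AMap fraction q"
    then obtain f g where p: "p = (a, b, f)" "f \<in> hom A a (OMap G (OMap F b))"
      and q: "q = (a, b, g)" "g \<in> hom A a (OMap G (OMap F b))"
      unfolding hom_kleisli_induced by blast
    have "path_class A \<Sigma> a b (roof b f) = path_class A \<Sigma> a b (roof b g)"
      using pq(3) by (simp add: p(1) q(1) fraction_def)
    note eq = F.source.path_class_eq[OF path_roof[OF o(2) p(2)], THEN iffD1, OF this]
    have "F.path_value b (roof b f) = F.path_value b (roof b g)"
      by (rule F.path_value_cong[OF _ eq]) (rule inverted_iso)
    then have "flat (OMap F b) f = flat (OMap F b) g"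
      unfolding path_value_roof[OF o(2) p(2)] path_value_roof[OF o(2) q(2)] .
    then have "sharp a (flat (OMap F b) f) = sharp a (flat (OMap F b) g)" by (rule arg_cong)
    then have "f = g"
      unfolding sharp_flat[OF F.OMap_Obj[OF o(2)] p(2)] sharp_flat[OF F.OMap_Obj[OF o(2)] q(2)] .
    then show "p = q" by (simp add: p(1) q(1))
  qed
  moreover have "AMap fraction ` hom kleisli a b = hom (fractions A \<Sigma>) a b"
  proof (intro set_eqI iffI)
    fix x assume "x \<in> hom (fractions A \<Sigma>) a b"
    then obtain w where w: "path A \<Sigma> a w b" and x: "x = (a, b, path_class A \<Sigma> a b w)"
      by (auto simp: F.source.hom_fractions)
    obtain f where f: "f \<in> hom A a (OMap G (OMap F b))" and eq: "path_eq A \<Sigma> a b w (roof b f)"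
      using path_eq_roof[OF w] by blast
    have "x = AMap fraction (a, b, f)"
      using F.source.path_class_eq[OF w, THEN iffD2, OF eq] x by (simp add: fraction_def)
    then show "x \<in> AMap fraction ` hom kleisli a b"
      using o f by (intro image_eqI[of _ _ "(a, b, f)"]) (simp_all add: hom_kleisli_induced)
  next
    fix x assume "x \<in> AMap fraction ` hom kleisli a b"
    then obtain p where "p \<in> hom kleisli a b" and x: "x = AMap fraction p" by blast
    from is_functor.AMap_hom[OF fraction_functor this(1)]
    show "x \<in> hom (fractions A \<Sigma>) a b" by (simp add: x fraction_def)
  qed
  ultimately show "bij_betw (AMap fraction) (hom kleisli a b)
      (hom (fractions A \<Sigma>) (OMap fraction a) (OMap fraction b))"
    by (simp add: bij_betw_def fraction_def)
qed

lemma fraction_isomorphism: "category_isomorphism kleisli (fractions A \<Sigma>) fraction"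
  using full_and_faithful_isomorphism[OF fraction_full_and_faithful]
  by (simp add: fraction_def kleisli_simps F.source.fractions_simps bij_betw_def)

lemma fraction_localization:
  "functor_eq A (fraction \<odot> kleisli_functor A (induced_monad F G \<eta> \<epsilon>)) (localization A \<Sigma>)"
proof -
  have "path_class A \<Sigma> a b (roof b (Comp A (\<eta> b) f)) = path_class A \<Sigma> a b [Fwd f]"
    if f: "f \<in> hom A a b" for f a b
  proof -
    have b: "b \<in> Obj A" using F.source.hom_Obj[OF f] by simp
    have pf: "path A \<Sigma> a [Fwd f] b" using f b by simp
    have r: "path_eq A \<Sigma> a b [Fwd f, Fwd (\<eta> b), Bwd (\<eta> b)] (roof b (Comp A (\<eta> b) f))"
      using F.source.path_eq_Fwd_Fwd[OF f unit_hom[OF b] path_Bwd_unit[OF b]] by (simp add: roof_def)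
    have "path_eq A \<Sigma> a b [Fwd f, Fwd (\<eta> b), Bwd (\<eta> b)] [Fwd f]"
      using path_append[OF path_refl[OF pf] path_Fwd_Bwd[OF unit_inverted[OF b] unit_hom[OF b]]] by simp
    from F.source.path_class_eq[OF pf, THEN iffD2, OF path_trans[OF path_sym[OF this] r]]
    show ?thesis ..
  qed
  from this[OF homI] show ?thesis
    by (simp add: functor_eq_def comp_functor_def fraction_def kleisli_functor_def localization_def
        induced_monad_def)
qed

end

section \<open>The structure of idempotent adjunctions\<close>

theorem mainTheorem3:
  fixes A :: "('o, 'm) cat" and B :: "('p, 'n) cat"
    and F :: "('o, 'm, 'p, 'n) func" and G :: "('p, 'n, 'o, 'm) func"
    and \<eta> :: "'o \<Rightarrow> 'm" and \<epsilon> :: "'p \<Rightarrow> 'n"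
  assumes "adjunction A B F G \<eta> \<epsilon>"
    and "idempotent_pair A B F G \<eta> \<epsilon>"
  shows
    "(is_equivalence (module_category A (induced_monad F G \<eta> \<epsilon>)) (Fix A \<eta>) forgetful \<and>
      Fix A \<eta> = image_closure A (G \<odot> F) \<and>
      reflective_subcategory A (Fix A \<eta>) (G \<odot> F)) \<and>
     (is_equivalence (comodule_category B (induced_comonad F G \<eta> \<epsilon>)) (Fix B \<epsilon>) forgetful \<and>
      Fix B \<epsilon> = image_closure B (F \<odot> G) \<and>
      coreflective_subcategory B (Fix B \<epsilon>) (F \<odot> G)) \<and>
     inverse_equivalences (image_closure A (G \<odot> F)) (image_closure B (F \<odot> G)) F G \<and>
     (inverted_arrows A A (G \<odot> F) = inverted_arrows A B F \<and>
      (\<exists>K. category_isomorphism (kleisli_category A (induced_monad F G \<eta> \<epsilon>))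
             (fractions A (inverted_arrows A A (G \<odot> F))) K \<and>
           functor_eq A (K \<odot> kleisli_functor A (induced_monad F G \<eta> \<epsilon>))
             (localization A (inverted_arrows A A (G \<odot> F)))))"
proof -
  interpret adjunction A B F G \<eta> \<epsilon> by fact
  interpret idempotent_adjunction A B F G \<eta> \<epsilon>
    by unfold_locales
      (use assms(2) in \<open>simp add: idempotent_pair_def natural_isomorphism_def
        natural_isomorphism_axioms_def\<close>)
  interpret d: idempotent_adjunction "dual B" "dual A" G F \<epsilon> \<eta> by (rule dual_idempotent)
  have "dual (Fix B \<epsilon>) = dual (image_closure B (F \<odot> G))"
    using d.Fix_eq_image_closure by (simp add: Fix_dual image_closure_dual)
  then have im: "Fix B \<epsilon> = image_closure B (F \<odot> G)" by (metis dual_dual)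
  have "coreflective_subcategory B (Fix B \<epsilon>) (F \<odot> G)"
    using coreflective_if_dual_reflective d.Fix_reflective by (simp add: Fix_dual)
  moreover have "inverse_equivalences (image_closure A (G \<odot> F)) (image_closure B (F \<odot> G)) F G"
    using Fix_equivalence unfolding Fix_eq_image_closure im .
  ultimately show ?thesis
    using modules_equivalence Fix_eq_image_closure Fix_reflective comodules_equivalence im
      inverted_arrows_eq fraction_isomorphism fraction_localization by auto
qed

end
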